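(* Let $\mathbb{K}$ be a field. White's conjecture (that $J_M=I_M$ for every matroid $M$) is true up to saturation. That is, for every matroid $M$ we have $J_M:\mathfrak{m}^{\infty}=I_M$, where $I_M$ is the toric ideal of $M$, $J_M$ is the ideal generated by the quadratic binomials corresponding to symmetric exchanges, and $\mathfrak{m}$ is the ideal generated by all variables in $S_M$.
   Context: Let $M$ be a matroid on a finite ground set $E$ with set of bases $\mathcal{B}$, and let $S_M=\mathbb{K}[y_B:B\in\mathcal{B}]$. The toric ideal $I_M$ is the kernel of the $\mathbb{K}$-algebra homomorphism $\varphi_M:S_M\to\mathbb{K}[x_e:e\in E]$, $y_B\mapsto\prod_{e\in B}x_e$. A pair of bases $D_1,D_2$ is obtained from a pair of bases $B_1,B_2$ by a symmetric exchange if $D_1=(B_1\setminus\{e\})\cup\{f\}$ and $D_2=(B_2\setminus\{f\})\cup\{e\}$ for some $e\in B_1$ and $f\in B_2$. The quadratic binomial corresponding to this symmetric exchange is $y_{B_1}y_{B_2}-y_{D_1}y_{D_2}$; it belongs to $I_M$. The saturation of an ideal $I\subset S_M$ with respect to $\mathfrak{m}$ is $I:\mathfrak{m}^\infty=\{a\in S_M: a\,\mathfrak{m}^n\subset I\text{ for some }n\in\mathbb{N}\}$.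
   Formalization: The matroid M is assumed to have positive rank (the empty set is not a basis); in rank 0 the claim is false, since there I_M is generated by y_∅ − 1 while J_M and its saturation are zero. *)

theory Defs
  imports "HOL-Library.Poly_Mapping" "HOL-Algebra.Ideal_Product"
begin

section \<open>Polynomial rings\<close>

text \<open>
  A monomial is a finitely supported exponent function on the variables, and a polynomial is a
  finitely supported coefficient function on the monomials.  Multiplication on this type is
  convolution.
\<close>

type_synonym ('v, 'k) mpoly = "('v \<Rightarrow>\<^sub>0 nat) \<Rightarrow>\<^sub>0 'k"

definition Const :: "'k::comm_ring_1 \<Rightarrow> ('v, 'k) mpoly"
  where "Const c = Poly_Mapping.single 0 c"

definition Var :: "'v \<Rightarrow> ('v, 'k::comm_ring_1) mpoly"
  where "Var v = Poly_Mapping.single (Poly_Mapping.single v 1) 1"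

text \<open>\<open>mpoly_ring V\<close> is the polynomial ring whose set of variables is exactly \<open>V\<close>.\<close>

definition mpoly_ring :: "'v set \<Rightarrow> ('v, 'k::comm_ring_1) mpoly ring"
  where "mpoly_ring V =
    \<lparr>carrier = {p. \<forall>m \<in> Poly_Mapping.keys p. Poly_Mapping.keys m \<subseteq> V},
     mult = (*), one = 1, zero = 0, add = (+)\<rparr>"

text \<open>The algebra homomorphism over the coefficients that sends each variable \<open>v\<close> to \<open>g v\<close>.\<close>

definition subst_monom :: "('v \<Rightarrow> ('w, 'k::comm_ring_1) mpoly) \<Rightarrow> ('v \<Rightarrow>\<^sub>0 nat) \<Rightarrow> ('w, 'k) mpoly"
  where "subst_monom g m = (\<Prod>v \<in> Poly_Mapping.keys m. g v ^ Poly_Mapping.lookup m v)"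

definition subst_hom :: "('v \<Rightarrow> ('w, 'k::comm_ring_1) mpoly) \<Rightarrow> ('v, 'k) mpoly \<Rightarrow> ('w, 'k) mpoly"
  where "subst_hom g p =
    (\<Sum>m \<in> Poly_Mapping.keys p. Const (Poly_Mapping.lookup p m) * subst_monom g m)"


section \<open>Saturation\<close>

primrec ideal_power :: "('a, 'b) ring_scheme \<Rightarrow> 'a set \<Rightarrow> nat \<Rightarrow> 'a set"
  where
    "ideal_power R I 0 = carrier R"
  | "ideal_power R I (Suc n) = ideal_prod R I (ideal_power R I n)"

definition saturation :: "('a, 'b) ring_scheme \<Rightarrow> 'a set \<Rightarrow> 'a set \<Rightarrow> 'a set"
  where "saturation R I \<mm> =
    {a \<in> carrier R. \<exists>n. (\<lambda>x. a \<otimes>\<^bsub>R\<^esub> x) ` ideal_power R \<mm> n \<subseteq> I}"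


section \<open>Matroids and their ideals\<close>

locale matroid =
  fixes E :: "'a set" and \<B> :: "'a set set"
  assumes finite_ground: "finite E"
    and bases_subset: "B \<in> \<B> \<Longrightarrow> B \<subseteq> E"
    and bases_nonempty: "\<B> \<noteq> {}"
    and basis_exchange:
      "\<lbrakk>B\<^sub>1 \<in> \<B>; B\<^sub>2 \<in> \<B>; e \<in> B\<^sub>1 - B\<^sub>2\<rbrakk> \<Longrightarrow> \<exists>f \<in> B\<^sub>2 - B\<^sub>1. insert f (B\<^sub>1 - {e}) \<in> \<B>"

abbreviation base_ring :: "'a set set \<Rightarrow> ('a set, 'k::field) mpoly ring"
  where "base_ring \<B> \<equiv> mpoly_ring \<B>"

definition toric_map :: "('a set, 'k::field) mpoly \<Rightarrow> ('a, 'k) mpoly"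
  where "toric_map = subst_hom (\<lambda>B. \<Prod>e \<in> B. Var e)"

definition toric_ideal :: "'a set \<Rightarrow> 'a set set \<Rightarrow> ('a set, 'k::field) mpoly set"
  where "toric_ideal E \<B> = a_kernel (base_ring \<B>) (mpoly_ring E) toric_map"

definition symmetric_exchange ::
    "'a set set \<Rightarrow> 'a set \<Rightarrow> 'a set \<Rightarrow> 'a set \<Rightarrow> 'a set \<Rightarrow> bool"
  where "symmetric_exchange \<B> B\<^sub>1 B\<^sub>2 D\<^sub>1 D\<^sub>2 \<longleftrightarrow>
    B\<^sub>1 \<in> \<B> \<and> B\<^sub>2 \<in> \<B> \<and> D\<^sub>1 \<in> \<B> \<and> D\<^sub>2 \<in> \<B> \<and>
    (\<exists>e \<in> B\<^sub>1. \<exists>f \<in> B\<^sub>2. D\<^sub>1 = (B\<^sub>1 - {e}) \<union> {f} \<and> D\<^sub>2 = (B\<^sub>2 - {f}) \<union> {e})"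

definition exchange_ideal :: "'a set set \<Rightarrow> ('a set, 'k::field) mpoly set"
  where "exchange_ideal \<B> = genideal (base_ring \<B>)
    {Var B\<^sub>1 * Var B\<^sub>2 - Var D\<^sub>1 * Var D\<^sub>2 |B\<^sub>1 B\<^sub>2 D\<^sub>1 D\<^sub>2. symmetric_exchange \<B> B\<^sub>1 B\<^sub>2 D\<^sub>1 D\<^sub>2}"

definition irrelevant_ideal :: "'a set set \<Rightarrow> ('a set, 'k::field) mpoly set"
  where "irrelevant_ideal \<B> = genideal (base_ring \<B>) (Var ` \<B>)"


section \<open>Basic facts about the encoding\<close>

lemma carrier_mpoly_ring:
  "p \<in> carrier (mpoly_ring V) \<longleftrightarrow> (\<forall>m \<in> Poly_Mapping.keys p. Poly_Mapping.keys m \<subseteq> V)"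
  by (simp add: mpoly_ring_def)

lemma mpoly_ring_simps [simp]:
  "mult (mpoly_ring V) = (*)" "one (mpoly_ring V) = 1"
  "zero (mpoly_ring V) = 0" "add (mpoly_ring V) = (+)"
  by (simp_all add: mpoly_ring_def)

lemma mpoly_ring_add_closed:
  "p \<in> carrier (mpoly_ring V) \<Longrightarrow> q \<in> carrier (mpoly_ring V) \<Longrightarrow> p + q \<in> carrier (mpoly_ring V)"
  unfolding carrier_mpoly_ring using keys_add[of p q] by blast

lemma mpoly_ring_uminus_closed:
  "p \<in> carrier (mpoly_ring V) \<Longrightarrow> - p \<in> carrier (mpoly_ring V)"
  unfolding carrier_mpoly_ring by (simp add: in_keys_iff)

lemma mpoly_ring_mult_closed:
  assumes "p \<in> carrier (mpoly_ring V)" "q \<in> carrier (mpoly_ring V)"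
  shows "p * q \<in> carrier (mpoly_ring V)"
  unfolding carrier_mpoly_ring
proof
  fix m assume "m \<in> Poly_Mapping.keys (p * q)"
  then obtain a b where "m = a + b" "a \<in> Poly_Mapping.keys p" "b \<in> Poly_Mapping.keys q"
    using keys_mult[of p q] by blast
  then show "Poly_Mapping.keys m \<subseteq> V"
    using assms keys_add[of a b] unfolding carrier_mpoly_ring by blast
qed

lemma cring_mpoly_ring: "cring (mpoly_ring V)"
proof (rule cringI)
  show "abelian_group (mpoly_ring V)"
  proof (rule abelian_groupI)
    fix p assume "p \<in> carrier (mpoly_ring V)"
    then show "\<exists>q \<in> carrier (mpoly_ring V). q \<oplus>\<^bsub>mpoly_ring V\<^esub> p = \<zero>\<^bsub>mpoly_ring V\<^esub>"
      by (intro bexI[of _ "- p"]) (auto intro: mpoly_ring_uminus_closed)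
  qed (auto simp: algebra_simps intro: mpoly_ring_add_closed, simp_all add: carrier_mpoly_ring)
  show "Group.comm_monoid (mpoly_ring V)"
    by (rule comm_monoidI)
      (auto simp: algebra_simps intro: mpoly_ring_mult_closed, simp_all add: carrier_mpoly_ring)
qed (simp add: algebra_simps)

lemma Var_in_mpoly_ring: "v \<in> V \<Longrightarrow> Var v \<in> carrier (mpoly_ring V)"
  by (simp add: carrier_mpoly_ring Var_def)

lemma Const_in_mpoly_ring: "Const c \<in> carrier (mpoly_ring V)"
  by (simp add: carrier_mpoly_ring Const_def)

lemma Const_simps:
  "Const 0 = 0" "Const 1 = 1" "Const (a + b) = Const a + Const b" "Const (a * b) = Const a * Const b"
  by (simp_all add: Const_def single_add mult_single)

lemma subst_monom_superset:
  assumes "finite A" "Poly_Mapping.keys m \<subseteq> A"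
  shows "subst_monom g m = (\<Prod>v \<in> A. g v ^ Poly_Mapping.lookup m v)"
  unfolding subst_monom_def
  by (rule prod.mono_neutral_left) (use assms in \<open>auto simp: in_keys_iff\<close>)

lemma subst_monom_add: "subst_monom g (a + b) = subst_monom g a * subst_monom g b"
proof -
  let ?A = "Poly_Mapping.keys a \<union> Poly_Mapping.keys b"
  have "subst_monom g (a + b) = (\<Prod>v \<in> ?A. g v ^ Poly_Mapping.lookup (a + b) v)"
    by (rule subst_monom_superset) (use keys_add[of a b] in auto)
  also have "\<dots> = (\<Prod>v \<in> ?A. g v ^ Poly_Mapping.lookup a v) * (\<Prod>v \<in> ?A. g v ^ Poly_Mapping.lookup b v)"
    by (simp add: lookup_add power_add prod.distrib)
  also have "\<dots> = subst_monom g a * subst_monom g b"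
    by (simp add: subst_monom_superset[of ?A])
  finally show ?thesis .
qed

lemma subst_hom_superset:
  assumes "finite A" "Poly_Mapping.keys p \<subseteq> A"
  shows "subst_hom g p = (\<Sum>m \<in> A. Const (Poly_Mapping.lookup p m) * subst_monom g m)"
  unfolding subst_hom_def
  by (rule sum.mono_neutral_left) (use assms in \<open>auto simp: in_keys_iff Const_simps\<close>)

lemma subst_hom_add: "subst_hom g (p + q) = subst_hom g p + subst_hom g q"
proof -
  let ?A = "Poly_Mapping.keys p \<union> Poly_Mapping.keys q"
  have "subst_hom g (p + q) = (\<Sum>m \<in> ?A. Const (Poly_Mapping.lookup (p + q) m) * subst_monom g m)"
    by (rule subst_hom_superset) (use keys_add[of p q] in auto)
  also have "\<dots> = (\<Sum>m \<in> ?A. Const (Poly_Mapping.lookup p m) * subst_monom g m)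
      + (\<Sum>m \<in> ?A. Const (Poly_Mapping.lookup q m) * subst_monom g m)"
    by (simp add: lookup_add Const_simps algebra_simps sum.distrib)
  also have "\<dots> = subst_hom g p + subst_hom g q"
    by (simp add: subst_hom_superset[of ?A])
  finally show ?thesis .
qed

lemma subst_hom_zero [simp]: "subst_hom g 0 = 0"
  by (simp add: subst_hom_def)

lemma subst_hom_single: "subst_hom g (Poly_Mapping.single m c) = Const c * subst_monom g m"
  by (subst subst_hom_superset[of "{m}"]) auto

lemma subst_hom_sum: "subst_hom g (sum h A) = (\<Sum>i \<in> A. subst_hom g (h i))"
  by (induction A rule: infinite_finite_induct) (auto simp: subst_hom_add)

lemma poly_mapping_sum_single:
  "p = (\<Sum>m \<in> Poly_Mapping.keys p. Poly_Mapping.single m (Poly_Mapping.lookup p m))"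
proof (rule poly_mapping_eqI)
  fix k
  have "Poly_Mapping.lookup (\<Sum>m \<in> Poly_Mapping.keys p. Poly_Mapping.single m (Poly_Mapping.lookup p m)) k
      = (\<Sum>m \<in> Poly_Mapping.keys p. if m = k then Poly_Mapping.lookup p m else 0)"
    by (simp add: lookup_sum lookup_single when_def)
  also have "\<dots> = Poly_Mapping.lookup p k"
    by (simp add: sum.delta in_keys_iff)
  finally show "Poly_Mapping.lookup p k = Poly_Mapping.lookup
      (\<Sum>m \<in> Poly_Mapping.keys p. Poly_Mapping.single m (Poly_Mapping.lookup p m)) k" by simp
qed

lemma subst_hom_mult: "subst_hom g (p * q) = subst_hom g p * subst_hom g q"
proof -
  have "subst_hom g (p * q) = subst_hom g
      ((\<Sum>m \<in> Poly_Mapping.keys p. Poly_Mapping.single m (Poly_Mapping.lookup p m)) *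
       (\<Sum>m \<in> Poly_Mapping.keys q. Poly_Mapping.single m (Poly_Mapping.lookup q m)))"
    using poly_mapping_sum_single[of p] poly_mapping_sum_single[of q] by simp
  also have "\<dots> = subst_hom g p * subst_hom g q"
    by (simp add: sum_product subst_hom_sum mult_single subst_hom_single subst_monom_add
        Const_simps subst_hom_def[of g p] subst_hom_def[of g q] mult_ac)
  finally show ?thesis .
qed

lemma subst_hom_Const [simp]: "subst_hom g (Const c) = Const c"
  by (simp add: Const_def[of c] subst_hom_single subst_monom_def)

lemma subst_hom_Var [simp]: "subst_hom g (Var v) = g v"
  by (simp add: Var_def subst_hom_single subst_monom_def Const_simps)

lemma mpoly_ring_prod_closed:
  "(\<And>i. i \<in> A \<Longrightarrow> h i \<in> carrier (mpoly_ring V)) \<Longrightarrow> prod h A \<in> carrier (mpoly_ring V)"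
  by (induction A rule: infinite_finite_induct)
    (auto intro: mpoly_ring_mult_closed simp: carrier_mpoly_ring[of 1])

lemma mpoly_ring_sum_closed:
  "(\<And>i. i \<in> A \<Longrightarrow> h i \<in> carrier (mpoly_ring V)) \<Longrightarrow> sum h A \<in> carrier (mpoly_ring V)"
  by (induction A rule: infinite_finite_induct)
    (auto intro: mpoly_ring_add_closed simp: carrier_mpoly_ring[of 0])

lemma mpoly_ring_power_closed:
  "p \<in> carrier (mpoly_ring V) \<Longrightarrow> p ^ n \<in> carrier (mpoly_ring V)"
  by (induction n) (auto intro: mpoly_ring_mult_closed simp: carrier_mpoly_ring[of 1])

lemma toric_map_Var: "toric_map (Var B) = (\<Prod>e \<in> B. Var e)"
  by (simp add: toric_map_def)

lemma toric_map_Const: "toric_map (Const c) = Const c"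
  by (simp add: toric_map_def)

lemma (in matroid) toric_map_ring_hom:
  "toric_map \<in> ring_hom (base_ring \<B> :: ('a set, 'k::field) mpoly ring) (mpoly_ring E)"
proof (rule ring_hom_memI)
  fix p :: "('a set, 'k) mpoly" assume p: "p \<in> carrier (base_ring \<B>)"
  show "toric_map p \<in> carrier (mpoly_ring E)"
    unfolding toric_map_def subst_hom_def subst_monom_def
    by (intro mpoly_ring_sum_closed mpoly_ring_mult_closed Const_in_mpoly_ring
        mpoly_ring_prod_closed mpoly_ring_power_closed Var_in_mpoly_ring)
      (use p bases_subset in \<open>auto simp: carrier_mpoly_ring\<close>)
next
  show "toric_map \<one>\<^bsub>base_ring \<B>\<^esub> = (\<one>\<^bsub>mpoly_ring E\<^esub> :: ('a, 'k) mpoly)"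
    using toric_map_Const[of "1 :: 'k"] by (simp add: Const_simps)
qed (simp_all add: toric_map_def subst_hom_add subst_hom_mult)

text \<open>
  In rank zero the only basis is \<open>{}\<close> and \<open>toric_map\<close> sends its variable to \<open>1\<close>, so the toric ideal
  is not homogeneous.  There are no exchange binomials, and saturating the zero ideal does not
  give the toric ideal; hence statements about saturation have to assume positive rank.
\<close>

lemma saturation_rank_zero:
  fixes E :: "'a set"
  assumes "finite E"
  shows "matroid E {{}}"
    and "saturation (base_ring {{}}) (exchange_ideal {{}}) (irrelevant_ideal {{}})
      \<noteq> (toric_ideal E {{}} :: ('a set, 'k::field) mpoly set)"
proof -
  show "matroid E {{}}"
    by standard (use assms in auto)
  let ?R = "base_ring {{}} :: ('a set, 'k) mpoly ring"
  interpret cring ?R by (rule cring_mpoly_ring)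
  define y :: "('a set, 'k) mpoly" where "y = Var {}"
  have y: "y \<in> carrier ?R"
    by (simp add: y_def Var_in_mpoly_ring)
  have pow: "y ^ n = Poly_Mapping.single (Poly_Mapping.single {} n) 1" for n
  proof (induction n)
    case (Suc n)
    have "Poly_Mapping.single ({} :: 'a set) (1 :: nat) + Poly_Mapping.single {} n = Poly_Mapping.single {} (Suc n)"
      by (metis plus_1_eq_Suc single_add)
    with Suc show ?case
      by (simp add: y_def Var_def mult_single)
  qed simp
  have "ideal {0} ?R"
    using zeroideal by simp
  then have "exchange_ideal {{}} \<subseteq> {0 :: ('a set, 'k) mpoly}"
    unfolding exchange_ideal_def by (rule genideal_minimal) (auto simp: symmetric_exchange_def)
  moreover have "y ^ n \<in> ideal_power ?R (irrelevant_ideal {{}}) n" for n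
  proof (induction n)
    case 0
    show ?case using one_closed by simp
  next
    case (Suc n)
    have "y \<in> irrelevant_ideal {{}}"
      unfolding irrelevant_ideal_def
      using genideal_self[of "Var ` {{}}"] y by (auto simp: y_def)
    from ideal_prod.prod[of y _ "y ^ n" _ ?R, OF this Suc] show ?case
      by simp
  qed
  moreover have "(y - 1) * y ^ n \<noteq> 0" for n
  proof
    assume "(y - 1) * y ^ n = 0"
    then have "y ^ Suc n = y ^ n"
      by (simp add: algebra_simps)
    then have "Poly_Mapping.keys (y ^ Suc n) = Poly_Mapping.keys (y ^ n)"
      by (rule arg_cong)
    then have "Poly_Mapping.single {} (Suc n) = Poly_Mapping.single ({} :: 'a set) n"
      unfolding pow by simp
    then have "Poly_Mapping.lookup (Poly_Mapping.single ({} :: 'a set) (Suc n)) {}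
        = Poly_Mapping.lookup (Poly_Mapping.single ({} :: 'a set) n) {}"
      by (rule arg_cong)
    then show False
      by simp
  qed
  ultimately have "y - 1 \<notin> saturation ?R (exchange_ideal {{}}) (irrelevant_ideal {{}})"
    unfolding saturation_def by (fastforce simp: image_subset_iff)
  moreover have minus_one: "y - 1 = y + Const (- 1)"
    by (simp add: Const_def single_uminus)
  have "y - 1 \<in> carrier ?R"
    unfolding minus_one by (rule mpoly_ring_add_closed[OF y Const_in_mpoly_ring])
  moreover have "toric_map (y - 1) = (0 :: ('a, 'k) mpoly)"
    unfolding minus_one unfolding toric_map_def subst_hom_add y_def subst_hom_Var subst_hom_Const
    by (simp add: Const_def single_uminus)
  ultimately show "saturation ?R (exchange_ideal {{}}) (irrelevant_ideal {{}}) \<noteq> toric_ideal E {{}}"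
    unfolding toric_ideal_def a_kernel_def' by auto
qed

end

theory Submission
  imports Defs "HOL-Algebra.RingHom" "HOL-Library.Multiset"
begin

text \<open>
  A product of basis variables is a multiset of bases.  Its image under the toric map records only
  its content, the multiset union of its bases, so the toric ideal is spanned by the differences
  of monomials with equal content.  On the other side, two monomials that are related by a chain
  of symmetric exchanges (\<open>exch_equiv\<close>) differ by an element of the exchange ideal.  The heart of
  the proof is combinatorial: for every basis \<open>B\<close>, two multisets of bases with equal content become
  related by exchanges once enough copies of \<open>B\<close> are added to both (\<open>exch_equiv_if_content_eq\<close>).

  To see this, treat \<open>B\<close> as invertible and identify it with the unit; this congruence is
  \<open>loc_equiv\<close>, written \<open>\<approx>\<close>.  A symmetric exchange between \<open>B\<close> and another basis \<open>A\<close> splits off a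
  basis that differs from \<open>B\<close> by a single element \<open>e\<close> entering and a single element \<open>f\<close> leaving, and moves
  \<open>A\<close> closer to \<open>B\<close>.  Hence every monomial is congruent to a product of such bases, that is, to a
  multiset of edges \<open>(e, f)\<close> of the fundamental bipartite graph of \<open>B\<close> (\<open>loc_decompose\<close>).  Equality of
  contents says that the two edge multisets \<open>P\<close> and \<open>Q\<close> have the same degree at every vertex.

  That such \<open>P\<close> and \<open>Q\<close> are congruent (\<open>edges_equiv\<close>) is shown by induction on their size.  As soon as
  \<open>P\<close> is congruent to some monomial that contains an edge of \<open>Q\<close>, this edge cancels and the induction
  hypothesis finishes the proof (\<open>shared_edge\<close>).  Following edges of \<open>Q\<close> and of \<open>P\<close> in turn yields a cycle
  \<open>e\<^sub>0, f\<^sub>1, e\<^sub>1, f\<^sub>2, \<dots>\<close> that alternates between the two.  If \<open>P\<close> has further edges, or if the cycle has a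
  chord, the induction hypothesis applied to a shorter piece brings in an edge of \<open>Q\<close>.  If the cycle
  has no chord and exhausts \<open>P\<close>, all of its edges in \<open>P\<close> but one form the unique perfect matching
  between their endpoints; therefore their product is congruent to a single basis
  (\<open>triangular_matching\<close>), and the symmetric exchange of this basis with the remaining edge again
  produces an edge of \<open>Q\<close>.

  It follows that every element of the toric ideal is carried into the exchange ideal by a power
  of each single variable, hence by all monomials of sufficiently high degree
  (\<open>saturation_if_Var_power\<close>).  Positive rank enters because multisets of bases with the same content
  must then have the same size, so that the same number of copies of \<open>B\<close> is added on both sides.
  The converse inclusion holds because the toric map sends variables to monomials, which are not
  zero divisors.
\<close>

section \<open>Bases of a matroid\<close>

context matroid
begin

lemma finite_basis: "A \<in> \<B> \<Longrightarrow> finite A"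
  using bases_subset finite_ground finite_subset by blast

lemma finite_bases: "finite \<B>"
  using bases_subset finite_ground by (meson finite_Pow_iff finite_subset PowI subsetI)

lemma bases_antichain:
  assumes "A \<in> \<B>" "D \<in> \<B>" "A \<subseteq> D"
  shows "A = D"
  using basis_exchange[OF assms(2,1)] assms(3) by blast

lemma card_bases_eq:
  assumes "A \<in> \<B>" "D \<in> \<B>"
  shows "card A = card D"
  using assms(1)
proof (induction "card (A - D)" arbitrary: A rule: less_induct)
  case less
  show ?case
  proof (cases "A \<subseteq> D")
    case True
    then show ?thesis using bases_antichain less.prems assms(2) by blast
  next
    case False
    then obtain e where e: "e \<in> A - D" by blast
    from basis_exchange[OF less.prems assms(2) e] obtain f
      where f: "f \<in> D - A" "insert f (A - {e}) \<in> \<B>" by blast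
    have fin: "finite A" using finite_basis less.prems by blast
    have "insert f (A - {e}) - D = (A - D) - {e}" using f by blast
    then have "card (insert f (A - {e}) - D) < card (A - D)"
      using e fin by (simp add: card_Diff1_less del: card_Diff_insert)
    from less.hyps[OF this f(2)] have "card (insert f (A - {e})) = card D" .
    moreover have "card (insert f (A - {e})) = card A"
      using e f fin by (metis DiffD1 DiffD2 card.insert card.remove finite_Diff insert_Diff insert_iff)
    ultimately show ?thesis by simp
  qed
qed

text \<open>
  The set \<open>S = {f \<in> B. insert e (B - {f}) \<in> \<B>}\<close> together with \<open>e\<close> is the fundamental circuit of \<open>e\<close> with
  respect to \<open>B\<close>.  Exchanging a basis \<open>D\<close> that contains it towards \<open>B\<close>, without ever removing \<open>e\<close>, ends
  with a basis of the form \<open>B - f + e\<close>; then \<open>f\<close> lies in \<open>S\<close> but not in the basis, a contradiction.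
\<close>

lemma fundamental_circuit_dependent:
  assumes B: "B \<in> \<B>" and e: "e \<notin> B" and D: "D \<in> \<B>"
    and sub: "insert e {f \<in> B. insert e (B - {f}) \<in> \<B>} \<subseteq> D"
  shows False
proof -
  let ?S = "{f \<in> B. insert e (B - {f}) \<in> \<B>}"
  show False
    using D sub
  proof (induction "card (D - B)" arbitrary: D rule: less_induct)
    case less
    have eD: "e \<in> D - B" using less.prems e by blast
    have fin: "finite D" "finite B" using finite_basis less.prems B by auto
    show False
    proof (cases "D - B = {e}")
      case True
      have "card (B - D) = card (D - B)"
        using card_bases_eq[OF less.prems(1) B] fin
        by (metis card_le_sym_Diff le_antisym order_refl)
      then obtain f where f: "B - D = {f}" using True
        by (metis One_nat_def card.empty card_1_singletonE card.insert empty_iff finite.emptyI)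
      have "insert e (B - {f}) = D" using f True by blast
      then have "f \<in> ?S" using f less.prems by auto
      then show False using less.prems f by blast
    next
      case False
      then obtain x where x: "x \<in> D - B" "x \<noteq> e" using eD by blast
      from basis_exchange[OF less.prems(1) B x(1)] obtain y
        where y: "y \<in> B - D" "insert y (D - {x}) \<in> \<B>" by blast
      have "insert y (D - {x}) - B = (D - B) - {x}" using y by blast
      then have "card (insert y (D - {x}) - B) < card (D - B)"
        using x fin by (simp add: card_Diff1_less del: card_Diff_insert)
      from less.hyps[OF this y(2)] show False using less.prems x by blast
    qed
  qed
qed

text \<open>
  With \<open>S\<close> as above, exchange \<open>B\<close> towards \<open>A\<close> while keeping all of \<open>S\<close>.  The resulting basis \<open>D\<close>
  satisfies \<open>S \<subseteq> D \<subseteq> A \<union> S\<close> and avoids \<open>e\<close>, so the element that replaces \<open>e\<close> when \<open>A\<close> is exchanged with \<open>D\<close>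
  must come from \<open>S\<close>, and this is the second half of the symmetric property.
\<close>

lemma symmetric_basis_exchange:
  assumes A: "A \<in> \<B>" and B: "B \<in> \<B>" and e: "e \<in> A - B"
  obtains f where "f \<in> B - A" "insert f (A - {e}) \<in> \<B>" "insert e (B - {f}) \<in> \<B>"
proof -
  define S where "S = {f \<in> B. insert e (B - {f}) \<in> \<B>}"
  have fin: "finite A" using finite_basis A by blast
  obtain D where D: "D \<in> \<B>" "S \<subseteq> D" "D - A \<subseteq> S"
  proof -
    have "\<exists>D \<in> \<B>. S \<subseteq> D \<and> D - A \<subseteq> S" if "C \<in> \<B>" "S \<subseteq> C" for C
      using that
    proof (induction "card (C - A)" arbitrary: C rule: less_induct)
      case less
      show ?case
      proof (cases "C - A \<subseteq> S")
        case True
        then show ?thesis using less.prems by blast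
      next
        case False
        then obtain y where y: "y \<in> C - A" "y \<notin> S" by blast
        from basis_exchange[OF less.prems(1) A y(1)] obtain x
          where x: "x \<in> A - C" "insert x (C - {y}) \<in> \<B>" by blast
        have "insert x (C - {y}) - A = (C - A) - {y}" using x by blast
        then have "card (insert x (C - {y}) - A) < card (C - A)"
          using y finite_basis[OF less.prems(1)] by (simp add: card_Diff1_less del: card_Diff_insert)
        from less.hyps[OF this x(2)] show ?thesis using less.prems y by blast
      qed
    qed
    from this[OF B] show ?thesis using that by (auto simp: S_def)
  qed
  have "e \<notin> D"
    using fundamental_circuit_dependent[OF B _ D(1), of e] D(2) e unfolding S_def by blast
  with e have "e \<in> A - D" by blast
  from basis_exchange[OF A D(1) this] obtain f
    where f: "f \<in> D - A" "insert f (A - {e}) \<in> \<B>" by blast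
  then have "f \<in> S" using D by blast
  then show ?thesis using that[of f] f unfolding S_def by blast
qed

end

section \<open>The congruence generated by symmetric exchanges\<close>

inductive exch_equiv :: "'a set set \<Rightarrow> 'a set multiset \<Rightarrow> 'a set multiset \<Rightarrow> bool"
  for \<B> where
  exch_step: "symmetric_exchange \<B> A B C D \<Longrightarrow> set_mset Z \<subseteq> \<B> \<Longrightarrow>
    exch_equiv \<B> ({#A, B#} + Z) ({#C, D#} + Z)"
| exch_equiv_refl: "exch_equiv \<B> X X"
| exch_equiv_sym: "exch_equiv \<B> X Y \<Longrightarrow> exch_equiv \<B> Y X"
| exch_equiv_trans: "exch_equiv \<B> X Y \<Longrightarrow> exch_equiv \<B> Y Z \<Longrightarrow> exch_equiv \<B> X Z"

lemma exch_equiv_add: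
  assumes "exch_equiv \<B> X Y" "set_mset Z \<subseteq> \<B>"
  shows "exch_equiv \<B> (X + Z) (Y + Z)"
  using assms
proof induction
  case (exch_step A B C D W)
  then have "exch_equiv \<B> ({#A, B#} + (W + Z)) ({#C, D#} + (W + Z))"
    by (intro exch_equiv.exch_step) auto
  then show ?case by (simp add: ac_simps)
qed (auto intro: exch_equiv.intros)

lemma exch_equiv_size: "exch_equiv \<B> X Y \<Longrightarrow> size X = size Y"
  by (induction rule: exch_equiv.induct) auto

text \<open>
  The exponent vector of the toric image of the monomial \<open>X\<close>.
\<close>

definition content :: "'a set multiset \<Rightarrow> 'a multiset"
  where "content X = (\<Sum>A \<in># X. mset_set A)"

lemma content_simps [simp]:
  "content {#} = {#}" "content (add_mset A X) = mset_set A + content X"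
  "content (X + Y) = content X + content Y"
  by (simp_all add: content_def)

lemma content_replicate: "content (replicate_mset n A) = repeat_mset n (mset_set A)"
  by (induction n) auto

context matroid
begin

text \<open>
  If one of two distinct exchanged elements lay in both bases, one of the results would be a proper
  subset of a basis.
\<close>

lemma symmetric_exchange_disjoint:
  assumes "A \<in> \<B>" "B \<in> \<B>" "e \<in> A" "f \<in> B"
    "(A - {e}) \<union> {f} \<in> \<B>" "(B - {f}) \<union> {e} \<in> \<B>" "e \<noteq> f"
  shows "f \<notin> A" "e \<notin> B"
proof -
  show "f \<notin> A"
  proof
    assume "f \<in> A"
    with assms have "(A - {e}) \<union> {f} = A - {e}" by blast
    then show False
      using bases_antichain[OF assms(5) assms(1)] assms(3,7) by auto
  qed
  show "e \<notin> B"
  proof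
    assume "e \<in> B"
    with assms have "(B - {f}) \<union> {e} = B - {f}" by blast
    then show False
      using bases_antichain[OF assms(6) assms(2)] assms(4,7) by auto
  qed
qed

lemma symmetric_exchange_content:
  assumes "symmetric_exchange \<B> A B C D"
  shows "mset_set A + mset_set B = mset_set C + mset_set D"
proof -
  from assms obtain e f where
    *: "A \<in> \<B>" "B \<in> \<B>" "C \<in> \<B>" "D \<in> \<B>" "e \<in> A" "f \<in> B"
    "C = (A - {e}) \<union> {f}" "D = (B - {f}) \<union> {e}"
    unfolding symmetric_exchange_def by blast
  have fin: "finite A" "finite B" "finite C" "finite D"
    using * finite_basis by auto
  show ?thesis
  proof (cases "e = f")
    case True
    then have "C = A" "D = B" using * by auto
    then show ?thesis by simp
  next
    case False
    then have "f \<notin> A" "e \<notin> B" using symmetric_exchange_disjoint * by metis+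
    with * False fin show ?thesis
      by (intro multiset_eqI) (auto simp: count_mset_set')
  qed
qed

lemma exch_equiv_content: "exch_equiv \<B> X Y \<Longrightarrow> content X = content Y"
  by (induction rule: exch_equiv.induct) (auto dest: symmetric_exchange_content simp: add.assoc[symmetric])

end

section \<open>Inverting a basis\<close>

text \<open>
  \<open>B\<close> is the basis whose variable is made invertible.
\<close>

locale based_matroid = matroid E \<B> for E :: "'a set" and \<B> +
  fixes B :: "'a set"
  assumes B: "B \<in> \<B>"
begin

text \<open>
  The numbers \<open>a\<close> and \<open>b\<close> may differ, so that \<open>B\<close> itself becomes congruent to the empty product.
  Exchanges preserve the size, hence \<open>a = b\<close> whenever \<open>X\<close> and \<open>Y\<close> have the same size.
\<close>

definition loc_equiv :: "'a set multiset \<Rightarrow> 'a set multiset \<Rightarrow> bool" (infix "\<approx>" 50)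
  where "X \<approx> Y \<longleftrightarrow> (\<exists>a b. exch_equiv \<B> (X + replicate_mset a B) (Y + replicate_mset b B))"

lemma loc_refl: "X \<approx> X"
  unfolding loc_equiv_def using exch_equiv_refl by blast

lemma loc_sym: "X \<approx> Y \<Longrightarrow> Y \<approx> X"
  unfolding loc_equiv_def using exch_equiv_sym by blast

lemma replicate_mset_add: "replicate_mset (m + n) x = replicate_mset m x + replicate_mset n x"
  by (rule multiset_eqI) simp

lemma replicate_B_subset: "set_mset (replicate_mset n B) \<subseteq> \<B>"
  using B by (auto simp: in_replicate_mset)

lemma loc_trans [trans]:
  assumes "X \<approx> Y" "Y \<approx> Z"
  shows "X \<approx> Z"
proof -
  from assms obtain a b c d where
    1: "exch_equiv \<B> (X + replicate_mset a B) (Y + replicate_mset b B)" and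
    2: "exch_equiv \<B> (Y + replicate_mset c B) (Z + replicate_mset d B)"
    unfolding loc_equiv_def by blast
  have 3: "exch_equiv \<B> (X + replicate_mset (a + c) B) (Y + replicate_mset (b + c) B)"
    using exch_equiv_add[OF 1 replicate_B_subset[of c]] by (simp add: replicate_mset_add ac_simps)
  have "exch_equiv \<B> (Y + replicate_mset (b + c) B) (Z + replicate_mset (b + d) B)"
    using exch_equiv_add[OF 2 replicate_B_subset[of b]] by (simp add: replicate_mset_add ac_simps)
  from exch_equiv_trans[OF 3 this] show ?thesis unfolding loc_equiv_def by blast
qed

lemma loc_add:
  assumes "X \<approx> Y" "set_mset Z \<subseteq> \<B>"
  shows "X + Z \<approx> Y + Z"
proof -
  from assms(1) obtain a b where
    1: "exch_equiv \<B> (X + replicate_mset a B) (Y + replicate_mset b B)"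
    unfolding loc_equiv_def by blast
  from exch_equiv_add[OF this assms(2)]
  have "exch_equiv \<B> ((X + Z) + replicate_mset a B) ((Y + Z) + replicate_mset b B)"
    by (simp add: ac_simps)
  then show ?thesis unfolding loc_equiv_def by blast
qed

lemma loc_add_both:
  assumes "X \<approx> X'" "Y \<approx> Y'" "set_mset Y \<subseteq> \<B>" "set_mset X' \<subseteq> \<B>"
  shows "X + Y \<approx> X' + Y'"
  using loc_trans[OF loc_add[OF assms(1,3)]] loc_add[OF assms(2,4)] by (simp add: ac_simps)

lemma loc_base: "add_mset B X \<approx> X"
  unfolding loc_equiv_def
  by (rule exI[of _ 0], rule exI[of _ 1]) (simp add: exch_equiv_refl)

lemma loc_exchange:
  assumes "A \<in> \<B>" "D \<in> \<B>" "e \<in> A - D" "f \<in> D - A"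
    "insert f (A - {e}) \<in> \<B>" "insert e (D - {f}) \<in> \<B>"
  shows "{#A, D#} \<approx> {#insert f (A - {e}), insert e (D - {f})#}"
proof -
  have "symmetric_exchange \<B> A D (insert f (A - {e})) (insert e (D - {f}))"
    unfolding symmetric_exchange_def using assms by auto
  from exch_step[OF this, of "{#}"] show ?thesis
    unfolding loc_equiv_def by (intro exI[of _ 0]) simp
qed

section \<open>The fundamental graph of a basis\<close>

definition edge :: "'a \<times> 'a \<Rightarrow> 'a set"
  where "edge p = insert (fst p) (B - {snd p})"

text \<open>
  The bipartite fundamental graph of \<open>B\<close>, with the elements outside \<open>B\<close> as first endpoints and the
  elements of \<open>B\<close> as second endpoints.
\<close>

definition G :: "('a \<times> 'a) set"
  where "G = {p. fst p \<notin> B \<and> snd p \<in> B \<and> edge p \<in> \<B>}"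

abbreviation edges :: "('a \<times> 'a) multiset \<Rightarrow> 'a set multiset"
  where "edges P \<equiv> image_mset edge P"

lemma edges_subset: "set_mset P \<subseteq> G \<Longrightarrow> set_mset (edges P) \<subseteq> \<B>"
  by (auto simp: G_def)

text \<open>
  Since \<open>B\<close> is a unit, a symmetric exchange between \<open>A\<close> and \<open>B\<close> factors \<open>A\<close>.
\<close>

lemma loc_exchange_base:
  assumes "A \<in> \<B>" "e \<in> A" "f \<notin> A" "(e, f) \<in> G" "insert f (A - {e}) \<in> \<B>"
  shows "{#A#} \<approx> {#edge (e, f), insert f (A - {e})#}"
proof -
  have ef: "e \<notin> B" "f \<in> B" "insert e (B - {f}) \<in> \<B>"
    using assms(4) by (auto simp: G_def edge_def)
  have "{#A#} \<approx> {#B, A#}" using loc_sym[OF loc_base] by simp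
  also have "\<dots> \<approx> {#insert e (B - {f}), insert f (A - {e})#}"
    by (rule loc_exchange) (use assms ef B in auto)
  finally show ?thesis by (simp add: edge_def)
qed

lemma loc_decompose_basis:
  assumes "A \<in> \<B>"
  shows "\<exists>P. set_mset P \<subseteq> G \<and> {#A#} \<approx> edges P"
  using assms
proof (induction "card (A - B)" arbitrary: A rule: less_induct)
  case less
  show ?case
  proof (cases "A \<subseteq> B")
    case True
    then have "A = B" using bases_antichain less.prems B by blast
    then have "{#A#} \<approx> edges {#}" using loc_base[of "{#}"] by simp
    then show ?thesis by (intro exI[of _ "{#}"]) auto
  next
    case False
    then obtain e where e: "e \<in> A - B" by blast
    from symmetric_basis_exchange[OF less.prems B e] obtain f where
      f: "f \<in> B - A" "insert f (A - {e}) \<in> \<B>" "insert e (B - {f}) \<in> \<B>" .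
    have "insert f (A - {e}) - B = (A - B) - {e}" using f by blast
    then have "card (insert f (A - {e}) - B) < card (A - B)"
      using e finite_basis[OF less.prems] by (simp add: card_Diff1_less del: card_Diff_insert)
    from less.hyps[OF this f(2)] obtain P where
      P: "set_mset P \<subseteq> G" "{#insert f (A - {e})#} \<approx> edges P" by blast
    have ef: "(e, f) \<in> G" using e f by (auto simp: G_def edge_def)
    have "{#A#} \<approx> {#edge (e, f), insert f (A - {e})#}"
      by (rule loc_exchange_base) (use less.prems e f ef in auto)
    also have "\<dots> \<approx> edges (add_mset (e, f) P)"
      using loc_add[OF P(2), of "{#edge (e, f)#}"] ef by (auto simp: G_def add_mset_commute)
    finally show ?thesis using P(1) ef by (intro exI[of _ "add_mset (e, f) P"]) auto
  qed
qed

lemma loc_decompose: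
  assumes "set_mset X \<subseteq> \<B>"
  shows "\<exists>P. set_mset P \<subseteq> G \<and> X \<approx> edges P"
  using assms
proof (induction X)
  case empty
  then show ?case using loc_refl by (intro exI[of _ "{#}"]) auto
next
  case (add A X)
  then obtain P where P: "set_mset P \<subseteq> G" "X \<approx> edges P" by auto
  from add.prems loc_decompose_basis[of A] obtain Q where
    Q: "set_mset Q \<subseteq> G" "{#A#} \<approx> edges Q" by auto
  have "{#A#} + X \<approx> edges Q + edges P"
    by (rule loc_add_both) (use P Q add.prems edges_subset in auto)
  then show ?case using P Q by (intro exI[of _ "Q + P"]) auto
qed

lemma content_edges:
  assumes "set_mset P \<subseteq> G"
  shows "content (edges P) + image_mset snd P = image_mset fst P + repeat_mset (size P) (mset_set B)"
  using assms
proof (induction P)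
  case (add p P)
  have fin: "finite B" using finite_basis B by blast
  from add.prems have p: "fst p \<notin> B" "snd p \<in> B" by (auto simp: G_def)
  have "mset_set (edge p) + {#snd p#} = {#fst p#} + mset_set B"
    using p fin by (simp add: edge_def mset_set.remove)
  then show ?case using add by (simp add: ac_simps)
qed simp

text \<open>
  The elements outside \<open>B\<close> and inside \<open>B\<close> occur with opposite signs in the difference between the
  content of an edge and that of \<open>B\<close>, so the content determines both degree vectors once the copies
  of \<open>B\<close> are accounted for; this is what the assumption on sizes does.
\<close>

lemma edges_degrees:
  assumes "set_mset P \<subseteq> G" "set_mset Q \<subseteq> G"
    and "content (edges P) + repeat_mset a (mset_set B) = content (edges Q) + repeat_mset b (mset_set B)"
    and "size P + a = size Q + b"
  shows "image_mset fst P = image_mset fst Q \<and> image_mset snd P = image_mset snd Q"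
proof -
  let ?b = "\<lambda>n. repeat_mset n (mset_set B)"
  have rep: "?b (m + n) = ?b m + ?b n" for m n by (rule repeat_mset_distrib)
  have "image_mset fst P + image_mset snd Q + ?b (size P + a)
    = (content (edges P) + ?b a) + image_mset snd P + image_mset snd Q"
    using content_edges[OF assms(1)] by (simp add: rep ac_simps)
  also have "\<dots> = image_mset fst Q + image_mset snd P + ?b (size Q + b)"
    unfolding assms(3) using content_edges[OF assms(2)] by (simp add: rep ac_simps)
  finally have eq: "image_mset fst P + image_mset snd Q = image_mset fst Q + image_mset snd P"
    using assms(4) by simp
  have fst: "filter_mset (\<lambda>x. x \<in> B) (image_mset fst R) = {#}"
       "filter_mset (\<lambda>x. x \<notin> B) (image_mset fst R) = image_mset fst R"
       "filter_mset (\<lambda>x. x \<in> B) (image_mset snd R) = image_mset snd R"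
       "filter_mset (\<lambda>x. x \<notin> B) (image_mset snd R) = {#}"
    if "set_mset R \<subseteq> G" for R
    using that by (auto simp: G_def filter_mset_eq_conv filter_mset_eq_mempty_iff)
  from arg_cong[OF eq, of "filter_mset (\<lambda>x. x \<in> B)"] arg_cong[OF eq, of "filter_mset (\<lambda>x. x \<notin> B)"]
  show ?thesis using assms(1,2) by (simp add: fst)
qed

lemma loc_equiv_degrees:
  assumes "set_mset P \<subseteq> G" "set_mset Q \<subseteq> G" "edges P \<approx> edges Q"
  shows "image_mset fst P = image_mset fst Q" "image_mset snd P = image_mset snd Q"
proof -
  from assms(3) obtain a b where
    *: "exch_equiv \<B> (edges P + replicate_mset a B) (edges Q + replicate_mset b B)"
    unfolding loc_equiv_def by blast
  from edges_degrees[OF assms(1,2), of a b] exch_equiv_content[OF *] exch_equiv_size[OF *]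
  show "image_mset fst P = image_mset fst Q" "image_mset snd P = image_mset snd Q"
    by (simp_all add: content_replicate)
qed

section \<open>Matchings that are products of a single basis\<close>

text \<open>
  If the edges of a matching can be ordered so that the second endpoint of each is not adjacent to
  the first endpoints of the edges after it in the list, the matching is the only perfect one
  between its endpoints.  In that case carrying out all the replacements simultaneously gives a
  basis \<open>T\<close>.  The edges are added from the end of the list: in the exchange of the basis obtained so
  far with the basis of the next edge \<open>(e, f)\<close>, the ordering excludes all elements but \<open>f\<close> as partners
  of \<open>e\<close>.  This exchange returns \<open>B\<close> and the next larger basis, which also proves that \<open>T\<close> is the
  product of the edges.
\<close>

lemma triangular_matching:
  assumes "set ps \<subseteq> G" "distinct (map fst ps)" "distinct (map snd ps)"
    and "sorted_wrt (\<lambda>p q. (fst q, snd p) \<notin> G) ps"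
  shows "(B - snd ` set ps) \<union> fst ` set ps \<in> \<B> \<and>
    {#(B - snd ` set ps) \<union> fst ` set ps#} \<approx> edges (mset ps)"
  using assms
proof (induction ps)
  case Nil
  then show ?case using B loc_base[of "{#}"] by simp
next
  case (Cons p ps)
  obtain e f where p: "p = (e, f)" by (cases p)
  define T where "T = (B - snd ` set ps) \<union> fst ` set ps"
  have T: "T \<in> \<B>" "{#T#} \<approx> edges (mset ps)"
    using Cons by (auto simp: T_def)
  have ef: "(e, f) \<in> G" "e \<notin> B" "f \<in> B" "insert e (B - {f}) \<in> \<B>"
    using Cons.prems p by (auto simp: G_def edge_def)
  have "fst ` set ps \<inter> B = {}" using Cons.prems by (auto simp: G_def)
  with ef have eT: "e \<notin> T" and fT: "f \<in> T" using Cons.prems p unfolding T_def by auto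
  have eq: "insert f (insert e (B - {f}) - {e}) = B" using ef by auto
  define Q where "Q = insert e (B - {f})"
  have "Q \<in> \<B>" "e \<in> Q - T" using ef eT by (auto simp: Q_def)
  from symmetric_basis_exchange[OF this(1) T(1) this(2)] obtain g where
    g: "g \<in> T - Q" "insert g (Q - {e}) \<in> \<B>" "insert e (T - {g}) \<in> \<B>" .
  have "g = f"
  proof (rule ccontr)
    assume "g \<noteq> f"
    with g(1) have "g \<notin> B" "g \<in> fst ` set ps" unfolding Q_def T_def by auto
    moreover have "insert g (Q - {e}) = edge (g, f)"
      using ef unfolding Q_def edge_def by auto
    ultimately have "(g, f) \<in> G" using g ef by (auto simp: G_def)
    with \<open>g \<in> fst ` set ps\<close> show False using Cons.prems p by auto
  qed
  have T': "insert e (T - {f}) = (B - snd ` set (p # ps)) \<union> fst ` set (p # ps)"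
    using Cons.prems(1-3) p ef by (auto simp: T_def G_def)
  have "{#insert e (T - {f})#} \<approx> {#B, insert e (T - {f})#}"
    using loc_sym[OF loc_base] by simp
  also have "{#Q, T#} \<approx> {#B, insert e (T - {f})#}"
    using loc_exchange[of Q T e f] \<open>Q \<in> \<B>\<close> T(1) \<open>e \<in> Q - T\<close> g fT \<open>g = f\<close> eq
    by (auto simp: Q_def)
  then have "{#B, insert e (T - {f})#} \<approx> {#Q, T#}" by (rule loc_sym)
  also have "\<dots> \<approx> edges (mset (p # ps))"
    using loc_add[OF T(2), of "{#Q#}"] \<open>Q \<in> \<B>\<close> p by (simp add: Q_def edge_def ac_simps)
  finally show ?case using g(3) unfolding \<open>g = f\<close> T' by simp
qed

section \<open>Edge multisets with equal degrees\<close>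

definition edges_equiv_below :: "nat \<Rightarrow> bool"
  where "edges_equiv_below n \<longleftrightarrow> (\<forall>P Q. size P < n \<longrightarrow> set_mset P \<subseteq> G \<longrightarrow> set_mset Q \<subseteq> G \<longrightarrow>
    image_mset fst P = image_mset fst Q \<longrightarrow> image_mset snd P = image_mset snd Q \<longrightarrow>
    edges P \<approx> edges Q)"

lemma edges_equiv_belowD:
  assumes "edges_equiv_below n" "size P < n" "set_mset P \<subseteq> G" "set_mset Q \<subseteq> G"
    "image_mset fst P = image_mset fst Q" "image_mset snd P = image_mset snd Q"
  shows "edges P \<approx> edges Q"
  using assms unfolding edges_equiv_below_def by blast

text \<open>
  The cofactor \<open>Z\<close> of the shared edge decomposes into edges.  Because congruence preserves degrees, these
  have the same degrees as \<open>Q\<close> without the shared edge, and there is one edge less than in \<open>P\<close>.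
\<close>

lemma shared_edge:
  assumes IH: "edges_equiv_below (size P)"
    and P: "set_mset P \<subseteq> G" and Q: "set_mset Q \<subseteq> G"
    and deg: "image_mset fst P = image_mset fst Q" "image_mset snd P = image_mset snd Q"
    and q: "q \<in># Q" and Z: "edges P \<approx> add_mset (edge q) Z" "set_mset Z \<subseteq> \<B>"
  shows "edges P \<approx> edges Q"
proof -
  from q obtain Q' where Q': "Q = add_mset q Q'" by (metis insert_DiffM)
  have qG: "q \<in> G" "edge q \<in> \<B>" using q Q by (auto simp: G_def)
  from loc_decompose[OF Z(2)] obtain P' where P': "set_mset P' \<subseteq> G" "Z \<approx> edges P'" by blast
  have *: "edges P \<approx> edges (add_mset q P')"
    using loc_trans[OF Z(1)] loc_add[OF P'(2), of "{#edge q#}"] qG by simp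
  have "image_mset fst P = image_mset fst (add_mset q P')" "image_mset snd P = image_mset snd (add_mset q P')"
    using loc_equiv_degrees[OF P _ *] P'(1) qG by auto
  then have "image_mset fst P' = image_mset fst Q'" "image_mset snd P' = image_mset snd Q'"
    using deg Q' by simp_all
  moreover have "size P' < size P"
    using \<open>image_mset fst P = image_mset fst (add_mset q P')\<close>
    by (metis lessI size_add_mset size_image_mset)
  ultimately have "edges P' \<approx> edges Q'"
    using edges_equiv_belowD[OF IH] P'(1) Q Q' by auto
  from loc_add[OF this, of "{#edge q#}"] qG have "edges (add_mset q P') \<approx> edges Q"
    using Q' by simp
  with * show ?thesis by (rule loc_trans)
qed

end

text \<open>
  The induction step, along a simple cycle \<open>e 0, f 1, e 1, \<dots>\<close> of length \<open>2 * k\<close> whose edges \<open>(e l, f l)\<close>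
  belong to \<open>P\<close> and whose edges \<open>(e l, f (Suc l))\<close> belong to \<open>Q\<close>.  Both sequences are taken to be periodic
  instead of finite; thereby the positions at which a chord may start and end need no reduction
  modulo \<open>k\<close>, and each chord can be written as \<open>(e i, f j)\<close> with \<open>j < i\<close>.
\<close>

lemma (in based_matroid) edges_equiv_along_cycle:
  assumes IH: "edges_equiv_below (size P)"
    and P: "set_mset P \<subseteq> G" and Q: "set_mset Q \<subseteq> G"
    and deg: "image_mset fst P = image_mset fst Q" "image_mset snd P = image_mset snd Q"
    and k: "0 < k"
    and per: "\<And>l. e (l + k) = e l" "\<And>l. f (l + k) = f l"
    and inj: "\<And>i j. i < j \<Longrightarrow> j < i + k \<Longrightarrow> e i \<noteq> e j" "\<And>i j. i < j \<Longrightarrow> j < i + k \<Longrightarrow> f i \<noteq> f j"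
    and eP: "\<And>l. (e l, f l) \<in># P" and eQ: "\<And>l. (e l, f (Suc l)) \<in># Q"
  shows "edges P \<approx> edges Q"
proof -
  note share = shared_edge[OF IH P Q deg]
  have GP: "(e l, f l) \<in> G" for l using eP P by blast
  have GQ: "(e l, f (Suc l)) \<in> G" for l using eQ Q by blast
  have in_B: "e l \<notin> B" "f l \<in> B" "e l \<noteq> f m" "f m \<noteq> e l" for l m using GP[of l] GP[of m] by (auto simp: G_def)
  have inj_on: "inj_on e {i..<j}" "inj_on f {i..<j}" if "j \<le> i + k" for i j
    by (rule linorder_inj_onI'; use inj that in force)+
  define arc where "arc i j = image_mset (\<lambda>l. (e l, f l)) (mset_set {i..<j})" for i j
  have arc_sub: "arc i j \<subseteq># P" if "j \<le> i + k" for i j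
  proof -
    have "arc i j = mset_set ((\<lambda>l. (e l, f l)) ` {i..<j})"
      unfolding arc_def
      by (rule image_mset_mset_set) (use inj_on(1)[OF that] in \<open>auto simp: inj_on_def\<close>)
    also have "\<dots> \<subseteq># P"
      by (rule subset_mset.order_trans[OF subset_imp_msubset_mset_set mset_set_set_mset_msubset])
        (use eP in auto)
    finally show ?thesis .
  qed
  have size_arc: "size (arc i j) = j - i" for i j by (simp add: arc_def)
  have k_le: "k \<le> size P"
    using size_mset_mono[OF arc_sub[of k 0]] by (simp add: size_arc)
  \<comment> \<open>The stretch from \<open>f j\<close> to \<open>e i\<close> is closed up by the chord \<open>(e i, f j)\<close>.  The induction hypothesis
    replaces its edges in \<open>P\<close> by its edges in \<open>Q\<close> and the chord; since \<open>j < i\<close>, at least one edge of \<open>Q\<close>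
    appears.  For \<open>i + 1 = j + k\<close> the stretch is the full cycle and the chord is itself an edge of \<open>Q\<close>.\<close>
  have chord: "edges P \<approx> edges Q"
    if i: "j < i" "i < j + k" "Suc i - j < size P" and ch: "(e i, f j) \<in> G" for i j
  proof -
    define R where "R = add_mset (e i, f j) (image_mset (\<lambda>l. (e l, f (Suc l))) (mset_set {j..<i}))"
    have arc: "arc j (Suc i) \<subseteq># P" using arc_sub i by simp
    then have PG: "set_mset (arc j (Suc i)) \<subseteq> G" using P by (meson set_mset_mono subset_trans)
    have RG: "set_mset R \<subseteq> G" using ch GQ by (auto simp: R_def)
    have "edges (arc j (Suc i)) \<approx> edges R"
    proof (rule edges_equiv_belowD[OF IH _ PG RG])
      show "size (arc j (Suc i)) < size P" using i by (simp add: size_arc)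
      have I1: "mset_set {j..<Suc i} = add_mset i (mset_set {j..<i})"
        using i by (simp add: atLeastLessThanSuc)
      have "{j..<Suc i} = insert j {Suc j..<Suc i}" using i by auto
      then have I2: "mset_set {j..<Suc i} = add_mset j (image_mset Suc (mset_set {j..<i}))"
        by (simp add: image_mset_mset_set)
      show "image_mset fst (arc j (Suc i)) = image_mset fst R"
        by (simp add: arc_def R_def I1 multiset.map_comp o_def)
      show "image_mset snd (arc j (Suc i)) = image_mset snd R"
        by (simp add: arc_def R_def I2 multiset.map_comp o_def)
    qed
    moreover have rest: "set_mset (edges (P - arc j (Suc i))) \<subseteq> \<B>"
      by (rule edges_subset) (use P in \<open>auto dest: in_diffD\<close>)
    ultimately have "edges (arc j (Suc i)) + edges (P - arc j (Suc i)) \<approx> edges R + edges (P - arc j (Suc i))"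
      by (rule loc_add)
    then have *: "edges P \<approx> edges R + edges (P - arc j (Suc i))"
      using arc by (simp flip: image_mset_union)
    have "(e j, f (Suc j)) \<in># R" using i by (auto simp: R_def)
    then obtain R' where "R = add_mset (e j, f (Suc j)) R'" by (metis insert_DiffM)
    moreover from this have "set_mset (edges R') \<subseteq> \<B>" using edges_subset[OF RG] by simp
    ultimately show ?thesis
      using share[OF eQ, of j "edges R' + edges (P - arc j (Suc i))"] * rest by simp
  qed
  show ?thesis
  proof (cases "k = 1")
    case True
    then have "(e 0, f 0) \<in># Q" using eQ[of 0] per(2)[of 0] by simp
    moreover obtain P' where P': "P = add_mset (e 0, f 0) P'" using eP by (metis insert_DiffM)
    ultimately show ?thesis
      using share[of "(e 0, f 0)" "edges P'"] loc_refl[of "edges P"] edges_subset[of P'] P by auto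
  next
    case False
    with k have k2: "2 \<le> k" by simp
    show ?thesis
    proof (cases "k < size P \<or> (\<exists>j i. j < i \<and> Suc i < j + k \<and> (e i, f j) \<in> G)")
      case True
      then show ?thesis
      proof
        assume "k < size P"
        then show ?thesis
          using chord[of 0 "k - 1"] GQ[of "k - 1"] per(2)[of 0] k2 by simp
      next
        assume "\<exists>j i. j < i \<and> Suc i < j + k \<and> (e i, f j) \<in> G"
        then show ?thesis using chord k_le by force
      qed
    next
      case False
      then have Pk: "size P = k" and chordless: "\<And>i j. j < i \<Longrightarrow> Suc i < j + k \<Longrightarrow> (e i, f j) \<notin> G"
        using k_le by auto
      have fk: "f k = f 0" using per(2)[of 0] by simp
      have kk: "{0..<k} = insert 0 {1..<k}" "{0..<k} = insert (k - 1) {0..<k - 1}"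
          "{1..<k} = Suc ` {0..<k - 1}"
        using k2 by (auto simp: image_iff)
      have P_eq: "P = add_mset (e 0, f 0) (arc 1 k)"
      proof -
        have "arc 0 k = P"
          using arc_sub[of k 0] Pk size_arc[of 0 k] mset_subset_size[of "arc 0 k" P]
          by (auto simp: subset_mset.less_le)
        then show ?thesis by (auto simp: arc_def kk(1))
      qed
      \<comment> \<open>The cycle minus \<open>(e 0, f 0)\<close> contributes the matching \<open>ps\<close> of edges of \<open>P\<close>, the cycle minus
        \<open>(e (k - 1), f k)\<close> the matching \<open>qs\<close> of edges of \<open>Q\<close>.  As there are no chords, both are triangular,
        in opposite directions along the cycle.\<close>
      define ps where "ps = map (\<lambda>l. (e l, f l)) [1..<k]"
      define qs where "qs = rev (map (\<lambda>l. (e l, f (Suc l))) [0..<k - 1])"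
      define T where "T = (B - snd ` set ps) \<union> fst ` set ps"
      define U where "U = (B - snd ` set qs) \<union> fst ` set qs"
      have T: "T \<in> \<B> \<and> {#T#} \<approx> edges (mset ps)"
        unfolding T_def
      proof (rule triangular_matching)
        show "set ps \<subseteq> G" using GP by (auto simp: ps_def)
        show "distinct (map fst ps)" "distinct (map snd ps)"
          using inj_on[of k 1] by (auto simp: ps_def distinct_map o_def inj_on_def)
        show "sorted_wrt (\<lambda>p q. (fst q, snd p) \<notin> G) ps"
          unfolding ps_def sorted_wrt_map
          by (rule sorted_wrt_mono_rel[OF _ sorted_wrt_upt]) (use chordless in auto)
      qed
      have f_Suc: "inj_on (\<lambda>l. f (Suc l)) {0..<k - 1}"
      proof -
        have "inj_on f {1..<k}" using inj_on(2)[of k 1] by simp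
        then show ?thesis unfolding kk(3) using comp_inj_on[of Suc "{0..<k - 1}" f]
          by (simp add: o_def del: image_Suc_atLeastLessThan)
      qed
      have U: "U \<in> \<B> \<and> {#U#} \<approx> edges (mset qs)"
        unfolding U_def
      proof (rule triangular_matching)
        show "set qs \<subseteq> G" using GQ by (auto simp: qs_def)
        show "distinct (map fst qs)" "distinct (map snd qs)"
          using inj_on(1)[of "k - 1" 0] inj_on_subset[OF f_Suc]
          by (auto simp: qs_def distinct_map o_def simp flip: rev_map)
        show "sorted_wrt (\<lambda>p q. (fst q, snd p) \<notin> G) qs"
          unfolding qs_def sorted_wrt_rev sorted_wrt_map
        proof (rule sorted_wrt_mono_rel[OF _ sorted_wrt_upt])
          \<comment> \<open>A nonadjacency that wraps around the cycle, hence the shift of \<open>i\<close> by one period.\<close>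
          fix i j assume ij: "i \<in> set [0..<k - 1]" "j \<in> set [0..<k - 1]" "i < j"
          then have "(e (i + k), f (Suc j)) \<notin> G" by (intro chordless) auto
        then show "(fst (e i, f (Suc i)), snd (e j, f (Suc j))) \<notin> G"
            using per(1) by simp
        qed
      qed
      have T_alt: "T = (B - f ` {1..<k}) \<union> e ` {1..<k}" by (auto simp: T_def ps_def image_image)
      have U_alt: "U = (B - f ` {1..<k}) \<union> e ` {0..<k - 1}"
        unfolding kk(3) by (simp add: U_def qs_def image_image del: image_Suc_atLeastLessThan)
      define A where "A = edge (e 0, f 0)"
      have A: "A \<in> \<B>" using GP[of 0] by (auto simp: A_def G_def)
      have last: "(e (k - 1), f 0) \<in># Q" using eQ[of "k - 1"] k2 fk by simp
      have e0: "e 0 \<notin> e ` {1..<k}" and f0: "f 0 \<notin> f ` {1..<k}"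
        using inj[of 0] by (metis image_iff atLeastLessThan_iff add_0 less_le_trans zero_less_one)+
      have PAT: "edges P \<approx> {#A, T#}"
      proof -
        have "mset ps = arc 1 k" by (simp add: ps_def arc_def)
        then have "edges P = edges (mset ps) + {#A#}" by (simp add: P_eq A_def)
        also have "{#T#} + {#A#} \<approx> \<dots>" using loc_add[of "{#T#}" _ "{#A#}"] T A by simp
        finally show ?thesis using loc_sym by (simp add: add_mset_commute)
      qed
      \<comment> \<open>Exchange \<open>e 0\<close> between the remaining edge and \<open>T\<close>.  Its partner \<open>g\<close> must be adjacent to \<open>f 0\<close> or equal to
        it.\<close>
      have "e 0 \<in> A - T" using e0 in_B by (auto simp: A_def edge_def T_alt)
      from symmetric_basis_exchange[OF A conjunct1[OF T] this] obtain g where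
        g: "g \<in> T - A" "insert g (A - {e 0}) \<in> \<B>" "insert (e 0) (T - {g}) \<in> \<B>" .
      have A_e: "A - {e 0} = B - {f 0}" using in_B by (auto simp: A_def edge_def)
      show ?thesis
      proof (cases "g = f 0")
        case False
        \<comment> \<open>The only neighbour of \<open>f 0\<close> in \<open>T\<close> is \<open>e (k - 1)\<close>, and this edge is in \<open>Q\<close>.\<close>
        with g(1) obtain i where i: "1 \<le> i" "i < k" "g = e i"
          unfolding T_alt A_def edge_def by auto
        have "(e i, f 0) \<in> G" using g(2) i in_B unfolding A_e by (auto simp: G_def edge_def)
        with chordless[of 0 i] i have "\<not> Suc i < k" by auto
        then have "i = k - 1" using i by simp
        then have "insert g (A - {e 0}) = edge (e (k - 1), f 0)" unfolding A_e by (simp add: edge_def i)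
        moreover have "{#A, T#} \<approx> {#insert g (A - {e 0}), insert (e 0) (T - {g})#}"
          by (rule loc_exchange) (use A T g \<open>e 0 \<in> A - T\<close> in auto)
        ultimately have "edges P \<approx> add_mset (edge (e (k - 1), f 0)) {#insert (e 0) (T - {g})#}"
          using loc_trans[OF PAT] by simp
        then show ?thesis by (rule share[OF last]) (use g in auto)
      next
        case True
        \<comment> \<open>Here all replacements along the cycle together form a basis \<open>W\<close>, congruent to \<open>P\<close>.  Exchanging
          \<open>e (k - 1)\<close> back for \<open>f 0\<close> leads to \<open>U\<close>, which is a basis by the other path, and
          therefore splits off the edge \<open>(e (k - 1), f 0)\<close> of \<open>Q\<close>.\<close>
        define W where "W = insert (e 0) (T - {f 0})"
        have W: "W \<in> \<B>" using g True by (simp add: W_def)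
        have "{#A, T#} \<approx> {#insert g (A - {e 0}), insert (e 0) (T - {g})#}"
          by (rule loc_exchange) (use A T g \<open>e 0 \<in> A - T\<close> in auto)
        also have "insert g (A - {e 0}) = B" unfolding A_e True using in_B by auto
        also have "{#B, insert (e 0) (T - {g})#} \<approx> {#W#}" unfolding True W_def by (rule loc_base)
        finally have PW: "edges P \<approx> {#W#}" by (rule loc_trans[OF PAT])
        have W_alt: "W = (B - f ` {0..<k}) \<union> e ` {0..<k}"
          unfolding W_def T_alt kk(1) using in_B by auto
        have e_last: "e (k - 1) \<notin> e ` {0..<k - 1}"
        proof
          assume "e (k - 1) \<in> e ` {0..<k - 1}"
          then obtain i where i: "i < k - 1" "e (k - 1) = e i" by auto
          moreover have "k - 1 < i + k" using k2 by linarith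
          ultimately show False using inj(1)[of i "k - 1"] by metis
        qed
        then have WU: "insert (f 0) (W - {e (k - 1)}) = U"
        proof -
          have "W - {e (k - 1)} = (B - insert (f 0) (f ` {1..<k})) \<union> e ` {0..<k - 1}"
            using e_last in_B unfolding W_alt
            by (subst (1) kk(1), subst (1) kk(2)) auto
          then show ?thesis using f0 in_B unfolding U_alt by auto
        qed
        have "{#W#} \<approx> {#edge (e (k - 1), f 0), U#}"
        proof -
          have "e (k - 1) \<in> W" "f 0 \<notin> W" using k2 in_B by (auto simp: W_alt)
          then show ?thesis
            using loc_exchange_base[of W "e (k - 1)" "f 0"] W U last Q unfolding WU by auto
        qed
        from loc_trans[OF PW this] show ?thesis
          by (intro share[OF last, of "{#U#}"]) (use U in auto)
      qed
    qed
  qed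
qed

text \<open>
  The alternating cycle arises as a periodic orbit, of least period \<open>k\<close>, of the map that goes along an
  edge of \<open>Q\<close> and back along an edge of \<open>P\<close>.
\<close>

lemma ex_least_period:
  fixes h :: "'a \<Rightarrow> 'a"
  assumes "finite A" "a \<in> A" "\<And>x. x \<in> A \<Longrightarrow> h x \<in> A"
  shows "\<exists>x \<in> A. \<exists>k > 0. (h ^^ k) x = x \<and> (\<forall>i j. i < j \<longrightarrow> j < i + k \<longrightarrow> (h ^^ i) x \<noteq> (h ^^ j) x)"
proof -
  have inA: "(h ^^ n) a \<in> A" for n by (induction n) (use assms in auto)
  have "\<not> inj (\<lambda>n. (h ^^ n) a)"
    using finite_subset[OF _ assms(1), of "range (\<lambda>n. (h ^^ n) a)"] inA
      finite_imageD[of "\<lambda>n. (h ^^ n) a" UNIV] by auto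
  then obtain m n where "m < n" "(h ^^ m) a = (h ^^ n) a"
    by (metis injI linorder_neqE_nat)
  define x where "x = (h ^^ m) a"
  have "(h ^^ (n - m)) x = x"
  proof -
    have "(h ^^ (n - m)) x = (h ^^ (n - m + m)) a" by (simp only: x_def funpow_add o_apply)
    then show ?thesis using \<open>m < n\<close> \<open>(h ^^ m) a = (h ^^ n) a\<close> by (simp add: x_def)
  qed
  define k where "k = (LEAST k. 0 < k \<and> (h ^^ k) x = x)"
  have k: "0 < k \<and> (h ^^ k) x = x"
    unfolding k_def by (rule LeastI[of _ "n - m"]) (use \<open>m < n\<close> \<open>(h ^^ (n - m)) x = x\<close> in simp)
  have per: "(h ^^ (l + c * k)) x = (h ^^ l) x" for l c
    by (induction c) (use k in \<open>simp_all add: funpow_add add.assoc[symmetric] add.commute[of k]\<close>)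
  have "(h ^^ i) x \<noteq> (h ^^ j) x" if "i < j" "j < i + k" for i j
  proof
    assume eq: "(h ^^ i) x = (h ^^ j) x"
    have "i \<le> i * k" using k by simp
    then have "(h ^^ (j - i)) x = (h ^^ ((i * k - i) + j)) x"
      using per[of "j - i" i] that by (simp add: algebra_simps)
    also have "\<dots> = (h ^^ ((i * k - i) + i)) x" using eq by (simp add: funpow_add)
    also have "\<dots> = x" using per[of 0 i] \<open>i \<le> i * k\<close> by simp
    finally have "(h ^^ (j - i)) x = x" .
    moreover have "j - i < k" using that by linarith
    ultimately show False
      using not_less_Least[of "j - i" "\<lambda>k. 0 < k \<and> (h ^^ k) x = x"] that(1) by (simp add: k_def)
  qed
  with k inA x_def show ?thesis by blast
qed

context based_matroid
begin

lemma edges_equiv: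
  assumes "set_mset P \<subseteq> G" "set_mset Q \<subseteq> G"
    and "image_mset fst P = image_mset fst Q" "image_mset snd P = image_mset snd Q"
  shows "edges P \<approx> edges Q"
  using assms
proof (induction "size P" arbitrary: P Q rule: less_induct)
  case less
  have IH: "edges_equiv_below (size P)"
    unfolding edges_equiv_below_def using less.hyps by blast
  note P = less.prems(1) and Q = less.prems(2) and deg = less.prems(3,4)
  show ?case
  proof (cases "P = {#}")
    case True
    then show ?thesis using deg loc_refl by simp
  next
    case False
    define A where "A = fst ` set_mset P"
    have setE: "fst ` set_mset P = fst ` set_mset Q" and setF: "snd ` set_mset P = snd ` set_mset Q"
      using deg by (metis set_image_mset)+
    define \<sigma> where "\<sigma> e = (SOME f. (e, f) \<in># Q)" for e
    define \<tau> where "\<tau> f = (SOME e. (e, f) \<in># P)" for f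
    have \<sigma>: "(e, \<sigma> e) \<in># Q" if "e \<in> A" for e
    proof -
      have "\<exists>f. (e, f) \<in># Q" using that setE by (auto simp: A_def)
      then show ?thesis unfolding \<sigma>_def by (rule someI_ex)
    qed
    have \<tau>: "(\<tau> f, f) \<in># P" if "f \<in> snd ` set_mset Q" for f
    proof -
      have "\<exists>e. (e, f) \<in># P" using that setF by force
      then show ?thesis unfolding \<tau>_def by (rule someI_ex)
    qed
    have \<tau>\<sigma>: "(\<tau> (\<sigma> e), \<sigma> e) \<in># P" if "e \<in> A" for e
      using \<tau>[of "\<sigma> e"] \<sigma>[OF that] by force
    have step: "(\<tau> \<circ> \<sigma>) e \<in> A" if "e \<in> A" for e
      using \<tau>\<sigma>[OF that] by (force simp: A_def)
    obtain a where "a \<in> A" using False unfolding A_def by (meson equals0I image_eqI set_mset_eq_empty_iff)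
    have "finite A" by (simp add: A_def)
    obtain x k where
      x: "x \<in> A" and k: "0 < k" "((\<tau> \<circ> \<sigma>) ^^ k) x = x" and
      inj: "\<And>i j. i < j \<Longrightarrow> j < i + k \<Longrightarrow> ((\<tau> \<circ> \<sigma>) ^^ i) x \<noteq> ((\<tau> \<circ> \<sigma>) ^^ j) x"
      using ex_least_period[OF \<open>finite A\<close> \<open>a \<in> A\<close>, of "\<tau> \<circ> \<sigma>", OF step] by blast
    define e where "e l = ((\<tau> \<circ> \<sigma>) ^^ l) x" for l
    \<comment> \<open>The vertex between the predecessor of \<open>e l\<close> on the orbit and \<open>e l\<close>; by periodicity, adding \<open>k - 1\<close>
      amounts to subtracting one.\<close>
    define f where "f l = \<sigma> (e (l + (k - 1)))" for l
    have eA: "e l \<in> A" for l unfolding e_def by (induction l) (use x step in auto)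
    have e_Suc: "e (Suc l) = \<tau> (\<sigma> (e l))" for l by (simp add: e_def)
    have e_per: "e (l + k) = e l" for l using k by (simp add: e_def funpow_add)
    have \<tau>f: "\<tau> (f l) = e l" for l
      using e_Suc[of "l + (k - 1)"] e_per[of l] k(1) by (simp add: f_def)
    have f_Suc: "f (Suc l) = \<sigma> (e l)" for l
      using e_per[of l] k(1) by (simp add: f_def)
    show ?thesis
    proof (rule edges_equiv_along_cycle[OF IH P Q deg k(1)])
      show "e (l + k) = e l" for l by (rule e_per)
      show "f (l + k) = f l" for l using e_per[of "l + (k - 1)"] by (simp add: f_def ac_simps)
      show "e i \<noteq> e j" if "i < j" "j < i + k" for i j using inj[OF that] by (simp add: e_def)
      then show "f i \<noteq> f j" if "i < j" "j < i + k" for i j using \<tau>f that by metis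
      show "(e l, f (Suc l)) \<in># Q" for l using \<sigma>[OF eA] by (simp add: f_Suc)
      show "(e l, f l) \<in># P" for l
        using \<tau>\<sigma>[OF eA, of "l + (k - 1)"] \<tau>f[of l] by (simp add: f_def)
    qed
  qed
qed

lemma loc_equiv_if_content_eq:
  assumes X: "set_mset X \<subseteq> \<B>" and Y: "set_mset Y \<subseteq> \<B>"
    and "content X = content Y" "size X = size Y"
  shows "X \<approx> Y"
proof -
  from loc_decompose[OF X] obtain P where P: "set_mset P \<subseteq> G" "X \<approx> edges P" by blast
  from loc_decompose[OF Y] obtain Q where Q: "set_mset Q \<subseteq> G" "Y \<approx> edges Q" by blast
  from P(2) obtain a a' where a: "exch_equiv \<B> (X + replicate_mset a B) (edges P + replicate_mset a' B)"
    unfolding loc_equiv_def by blast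
  from Q(2) obtain b b' where b: "exch_equiv \<B> (Y + replicate_mset b B) (edges Q + replicate_mset b' B)"
    unfolding loc_equiv_def by blast
  let ?b = "\<lambda>n. repeat_mset n (mset_set B)"
  have "content (edges P) + ?b (a' + b) = content X + ?b a + ?b b"
    using exch_equiv_content[OF a] by (simp add: content_replicate repeat_mset_distrib ac_simps)
  also have "\<dots> = content (edges Q) + ?b (b' + a)"
    using exch_equiv_content[OF b] assms(3) by (simp add: content_replicate repeat_mset_distrib ac_simps)
  finally have "image_mset fst P = image_mset fst Q \<and> image_mset snd P = image_mset snd Q"
    by (rule edges_degrees[OF P(1) Q(1)])
      (use exch_equiv_size[OF a] exch_equiv_size[OF b] assms(4) in simp)
  then have "edges P \<approx> edges Q" using edges_equiv P Q by blast
  then show ?thesis using P(2) Q(2) loc_trans loc_sym by blast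
qed

end

lemma (in matroid) content_size:
  assumes "set_mset X \<subseteq> \<B>" "A \<in> \<B>"
  shows "size (content X) = size X * card A"
  using assms(1)
proof (induction X)
  case (add D X)
  then show ?case using card_bases_eq[OF assms(2), of D] by simp
qed simp

text \<open>
  The factor \<open>card A\<close> is positive in positive rank.  So equal contents give equal sizes, and the two
  exponents of \<open>B\<close> in the congruence agree.
\<close>

lemma (in matroid) exch_equiv_if_content_eq:
  assumes X: "set_mset X \<subseteq> \<B>" and Y: "set_mset Y \<subseteq> \<B>"
    and eq: "content X = content Y" and pos: "{} \<notin> \<B>" and B: "B \<in> \<B>"
  shows "\<exists>n. exch_equiv \<B> (X + replicate_mset n B) (Y + replicate_mset n B)"
proof -
  interpret based_matroid E \<B> B by unfold_locales (rule B)
  have "card B > 0" using pos B finite_basis[OF B] by (auto simp: card_gt_0_iff)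
  then have size: "size X = size Y"
    using content_size[OF X B] content_size[OF Y B] eq by simp
  from loc_equiv_if_content_eq[OF X Y eq size] obtain a b where
    ab: "exch_equiv \<B> (X + replicate_mset a B) (Y + replicate_mset b B)"
    unfolding loc_equiv_def by blast
  from exch_equiv_size[OF this] size have "a = b" by simp
  with ab show ?thesis by blast
qed

section \<open>Monomials and the toric map\<close>

definition exponent :: "'v multiset \<Rightarrow> 'v \<Rightarrow>\<^sub>0 nat"
  where "exponent X = (\<Sum>v \<in># X. Poly_Mapping.single v 1)"

definition monomial :: "'v multiset \<Rightarrow> ('v, 'k::comm_ring_1) mpoly"
  where "monomial X = (\<Prod>v \<in># X. Var v)"

definition mset_of :: "('v \<Rightarrow>\<^sub>0 nat) \<Rightarrow> 'v multiset"
  where "mset_of m = Abs_multiset (Poly_Mapping.lookup m)"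

lemma count_mset_of [simp]: "count (mset_of m) = Poly_Mapping.lookup m"
  unfolding mset_of_def by (rule Abs_multiset_inverse) (simp add: finite_lookup)

lemma set_mset_of [simp]: "set_mset (mset_of m) = Poly_Mapping.keys m"
  by (auto simp: set_mset_def in_keys_iff)

lemma lookup_exponent [simp]: "Poly_Mapping.lookup (exponent X) v = count X v"
  by (induction X) (auto simp: exponent_def lookup_add lookup_single when_def)

lemma exponent_mset_of [simp]: "exponent (mset_of m) = m"
  by (rule poly_mapping_eqI) simp

lemma exponent_eq_iff [simp]: "exponent X = exponent Y \<longleftrightarrow> X = Y"
  by (metis lookup_exponent multiset_eqI)

lemma mset_of_add: "mset_of (m + m') = mset_of m + mset_of m'"
  by (rule multiset_eqI) (simp add: lookup_add)

lemma monomial_simps [simp]: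
  "monomial {#} = 1" "monomial (add_mset v X) = Var v * monomial X" "monomial (X + Y) = monomial X * monomial Y"
  "monomial (replicate_mset n v) = Var v ^ n"
  by (simp_all add: monomial_def)

lemma monomial_eq_single: "monomial X = Poly_Mapping.single (exponent X) 1"
  by (induction X) (simp_all add: exponent_def Var_def mult_single)

lemma single_eq_monomial: "Poly_Mapping.single m c = Const c * monomial (mset_of m)"
  by (simp add: monomial_eq_single Const_def mult_single)

lemma monomial_closed: "set_mset X \<subseteq> V \<Longrightarrow> monomial X \<in> carrier (mpoly_ring V)"
  unfolding carrier_mpoly_ring monomial_eq_single by (auto simp: in_keys_iff)

lemma mpoly_eq_sum_monomial:
  "p = (\<Sum>m \<in> Poly_Mapping.keys p. Const (Poly_Mapping.lookup p m) * monomial (mset_of m))"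
  using poly_mapping_sum_single[of p] by (simp add: single_eq_monomial)

lemma toric_map_add: "toric_map (p + q) = toric_map p + toric_map q"
  and toric_map_mult: "toric_map (p * q) = toric_map p * toric_map q"
  and toric_map_sum: "toric_map (sum h A) = (\<Sum>i \<in> A. toric_map (h i))"
  by (simp_all add: toric_map_def subst_hom_add subst_hom_mult subst_hom_sum)

lemma toric_map_monomial: "toric_map (monomial X) = monomial (content X)"
proof (induction X)
  case empty
  show ?case using toric_map_Const[of 1] by (simp add: Const_simps)
next
  case (add A X)
  then show ?case
    by (simp add: toric_map_mult toric_map_Var) (simp add: monomial_def prod_unfold_prod_mset)
qed

lemma mult_single_eq_0D:
  fixes p :: "('v, 'k::comm_ring_1) mpoly"
  assumes "p * Poly_Mapping.single k 1 = 0"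
  shows "p = 0"
proof (rule poly_mapping_eqI)
  fix t
  have "p * Poly_Mapping.single k 1
      = (\<Sum>m \<in> Poly_Mapping.keys p. Poly_Mapping.single (m + k) (Poly_Mapping.lookup p m))"
    by (subst poly_mapping_sum_single[of p]) (simp add: sum_distrib_right mult_single)
  then have "Poly_Mapping.lookup (p * Poly_Mapping.single k 1) (t + k)
      = (\<Sum>m \<in> Poly_Mapping.keys p. if m = t then Poly_Mapping.lookup p m else 0)"
    by (simp add: lookup_sum lookup_single when_def)
  also have "\<dots> = Poly_Mapping.lookup p t"
    by (simp add: sum.delta in_keys_iff)
  finally show "Poly_Mapping.lookup p t = Poly_Mapping.lookup 0 t"
    using assms by simp
qed

lemma Const_sum: "Const (sum c A) = (\<Sum>i \<in> A. Const (c i))"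
  by (induction A rule: infinite_finite_induct) (simp_all add: Const_simps)

text \<open>
  If the coefficients sum to zero on each fibre of \<open>g\<close>, subtracting from every monomial a fixed
  representative of its fibre does not change \<open>p\<close>.
\<close>

lemma fibre_binomial_decomposition:
  fixes p :: "('v, 'k::comm_ring_1) mpoly" and g :: "('v \<Rightarrow>\<^sub>0 nat) \<Rightarrow> 'b"
  assumes "\<And>t. (\<Sum>m | m \<in> Poly_Mapping.keys p \<and> g m = t. Poly_Mapping.lookup p m) = 0"
  shows "\<exists>r. (\<forall>m \<in> Poly_Mapping.keys p. r m \<in> Poly_Mapping.keys p \<and> g (r m) = g m) \<and>
    p = (\<Sum>m \<in> Poly_Mapping.keys p.
      Const (Poly_Mapping.lookup p m) * (monomial (mset_of m) - monomial (mset_of (r m))))"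
proof -
  let ?K = "Poly_Mapping.keys p" and ?c = "Poly_Mapping.lookup p"
  define \<rho> where "\<rho> t = (SOME m. m \<in> ?K \<and> g m = t)" for t
  have \<rho>: "\<rho> (g m) \<in> ?K \<and> g (\<rho> (g m)) = g m" if "m \<in> ?K" for m
    unfolding \<rho>_def by (rule someI[of _ m]) (use that in simp)
  have "(\<Sum>m \<in> ?K. Const (?c m) * monomial (mset_of (\<rho> (g m))))
      = (\<Sum>t \<in> g ` ?K. \<Sum>m | m \<in> ?K \<and> g m = t. Const (?c m) * monomial (mset_of (\<rho> (g m))))"
    by (rule sum.image_gen) simp
  also have "\<dots> = (\<Sum>t \<in> g ` ?K. Const (\<Sum>m | m \<in> ?K \<and> g m = t. ?c m) * monomial (mset_of (\<rho> t)))"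
    by (simp add: Const_sum sum_distrib_right)
  also have "\<dots> = 0" by (simp add: assms Const_simps)
  finally have "p = (\<Sum>m \<in> ?K. Const (?c m) * monomial (mset_of m))
      - (\<Sum>m \<in> ?K. Const (?c m) * monomial (mset_of (\<rho> (g m))))"
    using mpoly_eq_sum_monomial[of p] by simp
  then have "p = (\<Sum>m \<in> ?K. Const (?c m) * (monomial (mset_of m) - monomial (mset_of (\<rho> (g m)))))"
    by (simp add: sum_subtractf right_diff_distrib)
  with \<rho> show ?thesis by (intro exI[of _ "\<lambda>m. \<rho> (g m)"] conjI ballI; blast)
qed

lemma toric_kernel_fibre_sum:
  fixes p :: "('a set, 'k::field) mpoly"
  assumes "toric_map p = 0"
  shows "(\<Sum>m | m \<in> Poly_Mapping.keys p \<and> content (mset_of m) = T. Poly_Mapping.lookup p m) = 0"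
proof -
  have "toric_map p = (\<Sum>m \<in> Poly_Mapping.keys p. Const (Poly_Mapping.lookup p m) * monomial (content (mset_of m)))"
    by (subst mpoly_eq_sum_monomial) (simp add: toric_map_sum toric_map_mult toric_map_Const toric_map_monomial)
  then have "Poly_Mapping.lookup (toric_map p) (exponent T)
      = (\<Sum>m \<in> Poly_Mapping.keys p. if content (mset_of m) = T then Poly_Mapping.lookup p m else 0)"
    by (simp add: monomial_eq_single Const_def mult_single lookup_sum lookup_single when_def)
  also have "\<dots> = (\<Sum>m | m \<in> Poly_Mapping.keys p \<and> content (mset_of m) = T. Poly_Mapping.lookup p m)"
    by (simp add: sum.If_cases Collect_conj_eq)
  finally show ?thesis using assms by simp
qed

section \<open>Saturation in polynomial rings\<close>

lemma mpoly_ideal_simps: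
  assumes "ideal I (mpoly_ring V)"
  shows ideal_0: "0 \<in> I"
    and ideal_add: "p \<in> I \<Longrightarrow> q \<in> I \<Longrightarrow> p + q \<in> I"
    and ideal_mult: "p \<in> I \<Longrightarrow> c \<in> carrier (mpoly_ring V) \<Longrightarrow> c * p \<in> I"
    and ideal_uminus: "p \<in> I \<Longrightarrow> - p \<in> I"
    and ideal_subset: "I \<subseteq> carrier (mpoly_ring V)"
proof -
  interpret ideal I "mpoly_ring V" by (rule assms)
  show "0 \<in> I" using additive_subgroup.zero_closed[OF is_additive_subgroup] by simp
  show "p + q \<in> I" if "p \<in> I" "q \<in> I" using additive_subgroup.a_closed[OF is_additive_subgroup that] by simp
  show mult: "c * p \<in> I" if "p \<in> I" "c \<in> carrier (mpoly_ring V)" for c p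
    using I_l_closed[OF that] by simp
  show "- p \<in> I" if "p \<in> I"
    using mult[OF that Const_in_mpoly_ring[of "-1"]] by (simp add: Const_def single_uminus)
  show "I \<subseteq> carrier (mpoly_ring V)" by (rule a_subset)
qed

lemma ideal_sum:
  assumes "ideal I (mpoly_ring V)" "\<And>i. i \<in> A \<Longrightarrow> h i \<in> I"
  shows "sum h A \<in> I"
  using assms(2)
  by (induction A rule: infinite_finite_induct) (auto intro: ideal_0[OF assms(1)] ideal_add[OF assms(1)])

text \<open>
  The \<open>n\<close>-th power of the ideal generated by the variables, described by the degrees of the monomials
  that occur.
\<close>

definition high_degree :: "'v set \<Rightarrow> nat \<Rightarrow> ('v, 'k::comm_ring_1) mpoly set"
  where "high_degree V n =
    {p \<in> carrier (mpoly_ring V). \<forall>m \<in> Poly_Mapping.keys p. n \<le> size (mset_of m)}"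

lemma high_degree_add: "p \<in> high_degree V n \<Longrightarrow> q \<in> high_degree V n \<Longrightarrow> p + q \<in> high_degree V n"
  unfolding high_degree_def using keys_add[of p q] by (auto intro: mpoly_ring_add_closed)

lemma high_degree_mult:
  assumes "p \<in> high_degree V n" "q \<in> high_degree V k"
  shows "p * q \<in> high_degree V (n + k)"
proof -
  have "n + k \<le> size (mset_of m)" if "m \<in> Poly_Mapping.keys (p * q)" for m
  proof -
    from that obtain a b where "m = a + b" "a \<in> Poly_Mapping.keys p" "b \<in> Poly_Mapping.keys q"
      using keys_mult[of p q] by blast
    then show ?thesis using assms by (auto simp: high_degree_def mset_of_add intro: add_mono)
  qed
  then show ?thesis using assms by (auto simp: high_degree_def intro: mpoly_ring_mult_closed)
qed

lemma high_degree_ideal: "ideal (high_degree V n :: ('v, 'k::comm_ring_1) mpoly set) (mpoly_ring V)"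
proof -
  let ?R = "mpoly_ring V :: ('v, 'k) mpoly ring"
  interpret cring ?R by (rule cring_mpoly_ring)
  have carrier: "carrier ?R = high_degree V 0" by (simp add: high_degree_def)
  have minus: "\<ominus>\<^bsub>?R\<^esub> p = - p" if "p \<in> carrier ?R" for p
    by (rule minus_equality) (use that mpoly_ring_uminus_closed in auto)
  show ?thesis
  proof (rule idealI)
    show "ring ?R" by (rule ring_axioms)
    show "subgroup (high_degree V n) (add_monoid ?R)"
    proof (rule subgroup.intro)
      show "inv\<^bsub>add_monoid ?R\<^esub> p \<in> high_degree V n" if "p \<in> high_degree V n" for p
        using that minus[of p] unfolding a_inv_def high_degree_def
        by (auto intro: mpoly_ring_uminus_closed simp: in_keys_iff)
    qed (auto simp: high_degree_add, auto simp: high_degree_def carrier_mpoly_ring)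
    show "x \<otimes>\<^bsub>?R\<^esub> a \<in> high_degree V n" "a \<otimes>\<^bsub>?R\<^esub> x \<in> high_degree V n"
      if "a \<in> high_degree V n" "x \<in> carrier ?R" for a x
      using high_degree_mult[of x V 0 a n] high_degree_mult[of a V n x 0] that carrier by auto
  qed
qed

lemma irrelevant_ideal_high_degree: "irrelevant_ideal \<B> \<subseteq> high_degree \<B> 1"
proof -
  interpret cring "base_ring \<B>" by (rule cring_mpoly_ring)
  have "Var ` \<B> \<subseteq> high_degree \<B> 1"
  proof -
    have "Var A \<in> high_degree \<B> 1" if "A \<in> \<B>" for A
    proof -
      have "mset_of (Poly_Mapping.single A 1) = {#A#}"
        by (rule multiset_eqI) (simp add: lookup_single when_def)
      then show ?thesis
        using Var_in_mpoly_ring[OF that] by (simp add: high_degree_def Var_def)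
    qed
    then show ?thesis by blast
  qed
  then show ?thesis unfolding irrelevant_ideal_def
    by (intro genideal_minimal high_degree_ideal)
qed

lemma ideal_power_high_degree:
  assumes "I \<subseteq> high_degree V 1"
  shows "ideal_power (mpoly_ring V) I n \<subseteq> high_degree V n"
proof (induction n)
  case 0
  show ?case by (simp add: high_degree_def)
next
  case (Suc n)
  have "p \<in> high_degree V (Suc n)" if "p \<in> ideal_prod (mpoly_ring V) I (ideal_power (mpoly_ring V) I n)" for p
    using that
  proof (induction rule: ideal_prod.induct)
    case (prod i j)
    then show ?case using high_degree_mult[of i V 1 j n] assms Suc by auto
  next
    case (sum s t)
    then show ?case using high_degree_add by simp
  qed
  then show ?case by auto
qed

lemma Var_power_in_ideal_power: "A \<in> \<B> \<Longrightarrow> Var A ^ n \<in> ideal_power (base_ring \<B>) (irrelevant_ideal \<B>) n"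
proof (induction n)
  case 0
  show ?case by (simp add: carrier_mpoly_ring)
next
  case (Suc n)
  interpret cring "base_ring \<B>" by (rule cring_mpoly_ring)
  have "Var ` \<B> \<subseteq> irrelevant_ideal \<B>"
    unfolding irrelevant_ideal_def by (rule genideal_self) (use Var_in_mpoly_ring in auto)
  with Suc.prems have "Var A \<in> irrelevant_ideal \<B>" by blast
  from ideal_prod.prod[OF this Suc.IH[OF Suc.prems], of "base_ring \<B>"] show ?case by simp
qed

text \<open>
  By the pigeonhole principle a monomial whose degree exceeds the sum of the exponents \<open>n v\<close> is
  divisible by one of the powers \<open>Var v ^ n v\<close>.
\<close>

lemma saturation_if_Var_power:
  fixes a :: "('v, 'k::comm_ring_1) mpoly"
  assumes I: "ideal I (mpoly_ring V)" and V: "finite V" and M: "M \<subseteq> high_degree V 1"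
    and a: "a \<in> carrier (mpoly_ring V)" and ex: "\<And>v. v \<in> V \<Longrightarrow> \<exists>n. Var v ^ n * a \<in> I"
  shows "a \<in> saturation (mpoly_ring V) I M"
proof -
  from ex obtain n where n: "\<And>v. v \<in> V \<Longrightarrow> Var v ^ n v * a \<in> I" by metis
  define N where "N = Suc (\<Sum>v \<in> V. n v)"
  have monomial: "a * monomial X \<in> I" if X: "set_mset X \<subseteq> V" "N \<le> size X" for X
  proof -
    have "\<exists>v \<in> V. n v \<le> count X v"
    proof (rule ccontr)
      assume "\<not> ?thesis"
      then have "(\<Sum>v \<in> V. count X v) \<le> (\<Sum>v \<in> V. n v)" by (intro sum_mono) auto
      moreover have "size X \<le> (\<Sum>v \<in> V. count X v)"
        unfolding size_multiset_overloaded_eq by (rule sum_mono2) (use X V in auto)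
      ultimately show False using X(2) by (simp add: N_def)
    qed
    then obtain v where v: "v \<in> V" "replicate_mset (n v) v \<subseteq># X"
      by (auto simp: count_le_replicate_mset_subset_eq)
    then obtain Y where Y: "X = replicate_mset (n v) v + Y" by (auto simp: subset_mset.le_iff_add)
    then have "a * monomial X = monomial Y * (Var v ^ n v * a)" by (simp add: ac_simps)
    also have "\<dots> \<in> I"
      by (rule ideal_mult[OF I n[OF v(1)] monomial_closed]) (use X Y in auto)
    finally show ?thesis .
  qed
  have "a * x \<in> I" if "x \<in> high_degree V N" for x
  proof -
    have "a * x = (\<Sum>m \<in> Poly_Mapping.keys x. Const (Poly_Mapping.lookup x m) * (a * monomial (mset_of m)))"
      by (subst mpoly_eq_sum_monomial[of x]) (simp add: sum_distrib_left ac_simps)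
    also have "\<dots> \<in> I"
      by (intro ideal_sum[OF I] ideal_mult[OF I _ Const_in_mpoly_ring] monomial)
        (use that in \<open>auto simp: high_degree_def carrier_mpoly_ring\<close>)
    finally show ?thesis .
  qed
  then have "(\<lambda>x. a * x) ` ideal_power (mpoly_ring V) M N \<subseteq> I"
    using ideal_power_high_degree[OF M, of N] by blast
  then show ?thesis using a unfolding saturation_def by auto
qed

section \<open>The exchange ideal and the toric ideal\<close>

lemma exchange_ideal_ideal:
  "ideal (exchange_ideal \<B> :: ('a set, 'k::field) mpoly set) (base_ring \<B>)"
  and exchange_binomial_in_ideal:
  "symmetric_exchange \<B> A B C D \<Longrightarrow> Var A * Var B - Var C * Var D \<in> (exchange_ideal \<B> :: ('a set, 'k) mpoly set)"
proof -
  let ?R = "base_ring \<B> :: ('a set, 'k) mpoly ring"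
  interpret cring ?R by (rule cring_mpoly_ring)
  let ?S = "{Var A * Var B - Var C * Var D | A B C D. symmetric_exchange \<B> A B C D} :: ('a set, 'k) mpoly set"
  have sub: "?S \<subseteq> carrier ?R"
  proof -
    have "Var A * Var B + - (Var C * Var D) \<in> carrier ?R" if "symmetric_exchange \<B> A B C D" for A B C D
      using that by (intro mpoly_ring_add_closed mpoly_ring_uminus_closed mpoly_ring_mult_closed Var_in_mpoly_ring)
        (auto simp: symmetric_exchange_def)
    then show ?thesis by auto
  qed
  show "ideal (exchange_ideal \<B>) ?R"
    unfolding exchange_ideal_def by (rule genideal_ideal[OF sub])
  show "Var A * Var B - Var C * Var D \<in> (exchange_ideal \<B> :: ('a set, 'k) mpoly set)"
    if "symmetric_exchange \<B> A B C D"
    using genideal_self[OF sub] that unfolding exchange_ideal_def by blast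
qed

lemma exch_equiv_monomial:
  assumes "exch_equiv \<B> X Y"
  shows "monomial X - monomial Y \<in> (exchange_ideal \<B> :: ('a set, 'k::field) mpoly set)"
  using assms
proof induction
  case (exch_step A B C D Z)
  have "monomial Z * (Var A * Var B - Var C * Var D) \<in> (exchange_ideal \<B> :: ('a set, 'k) mpoly set)"
    by (rule ideal_mult[OF exchange_ideal_ideal exchange_binomial_in_ideal monomial_closed]) (use exch_step in auto)
  then show ?case by (simp add: algebra_simps)
next
  case (exch_equiv_refl X)
  show ?case using ideal_0[OF exchange_ideal_ideal] by simp
next
  case (exch_equiv_sym X Y)
  from ideal_uminus[OF exchange_ideal_ideal exch_equiv_sym.IH] show ?case by simp
next
  case (exch_equiv_trans X Y Z)
  from ideal_add[OF exchange_ideal_ideal exch_equiv_trans.IH] show ?case by simp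
qed

context matroid
begin

lemma in_toric_ideal_iff:
  "p \<in> toric_ideal E \<B> \<longleftrightarrow> p \<in> carrier (base_ring \<B>) \<and> toric_map p = 0"
  by (simp add: toric_ideal_def a_kernel_def')

lemma toric_ideal_ideal: "ideal (toric_ideal E \<B> :: ('a set, 'k::field) mpoly set) (base_ring \<B>)"
  unfolding toric_ideal_def
  by (intro ring_hom_ring.kernel_is_ideal ring_hom_ringI2 toric_map_ring_hom cring.axioms(1) cring_mpoly_ring)

lemma exchange_ideal_subset_toric_ideal:
  "exchange_ideal \<B> \<subseteq> (toric_ideal E \<B> :: ('a set, 'k::field) mpoly set)"
proof -
  interpret cring "base_ring \<B> :: ('a set, 'k) mpoly ring" by (rule cring_mpoly_ring)
  have "Var A * Var B - Var C * Var D \<in> (toric_ideal E \<B> :: ('a set, 'k) mpoly set)"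
    if ex: "symmetric_exchange \<B> A B C D" for A B C D
  proof -
    have "toric_map (Var C * Var D) = toric_map (Var A * Var B :: ('a set, 'k) mpoly)"
      using symmetric_exchange_content[OF ex]
        toric_map_monomial[of "{#A, B#}", where ?'b = 'k]
        toric_map_monomial[of "{#C, D#}", where ?'b = 'k]
      by (simp flip: monomial_simps(3))
    moreover have "toric_map (Var A * Var B - Var C * Var D) + toric_map (Var C * Var D)
        = toric_map (Var A * Var B :: ('a set, 'k) mpoly)"
      unfolding toric_map_add[symmetric] by simp
    moreover have "Var A * Var B - Var C * Var D \<in> carrier (base_ring \<B> :: ('a set, 'k) mpoly ring)"
      using exchange_binomial_in_ideal[OF ex] ideal_subset[OF exchange_ideal_ideal] by blast
    ultimately show ?thesis by (simp add: in_toric_ideal_iff)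
  qed
  then show ?thesis
    unfolding exchange_ideal_def by (intro genideal_minimal toric_ideal_ideal) auto
qed

text \<open>
  An element of the toric ideal is a combination of finitely many differences of monomials with
  equal content; each is carried into the exchange ideal by some power of the variable of \<open>B\<close>, and
  the sum of the exponents works for all of them.
\<close>

lemma Var_power_mult_toric_ideal:
  fixes p :: "('a set, 'k::field) mpoly"
  assumes p: "p \<in> toric_ideal E \<B>" and pos: "{} \<notin> \<B>" and B: "B \<in> \<B>"
  shows "\<exists>n. Var B ^ n * p \<in> exchange_ideal \<B>"
proof -
  note J = exchange_ideal_ideal[of \<B>, where ?'k = 'k]
  have keys: "set_mset (mset_of m) \<subseteq> \<B>" if "m \<in> Poly_Mapping.keys p" for m
    using p that by (simp add: in_toric_ideal_iff carrier_mpoly_ring)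
  from p have "toric_map p = 0" by (simp add: in_toric_ideal_iff)
  from fibre_binomial_decomposition[of p "\<lambda>m. content (mset_of m)", OF toric_kernel_fibre_sum[OF this]]
  obtain r where r: "\<And>m. m \<in> Poly_Mapping.keys p \<Longrightarrow>
      r m \<in> Poly_Mapping.keys p \<and> content (mset_of (r m)) = content (mset_of m)"
    and p_eq: "p = (\<Sum>m \<in> Poly_Mapping.keys p.
      Const (Poly_Mapping.lookup p m) * (monomial (mset_of m) - monomial (mset_of (r m))))"
    by blast
  have "\<exists>n. Var B ^ n * (monomial (mset_of m) - monomial (mset_of (r m))) \<in> (exchange_ideal \<B> :: ('a set, 'k) mpoly set)"
    if "m \<in> Poly_Mapping.keys p" for m
  proof -
    from exch_equiv_if_content_eq[OF keys keys _ pos B, of m "r m"] r[OF that] that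
    obtain n where "exch_equiv \<B> (mset_of m + replicate_mset n B) (mset_of (r m) + replicate_mset n B)"
      by auto
    from exch_equiv_monomial[OF this, where ?'k = 'k] show ?thesis
      by (intro exI[of _ n]) (simp add: algebra_simps)
  qed
  then obtain n where n: "\<And>m. m \<in> Poly_Mapping.keys p \<Longrightarrow>
      Var B ^ n m * (monomial (mset_of m) - monomial (mset_of (r m))) \<in> (exchange_ideal \<B> :: ('a set, 'k) mpoly set)"
    by metis
  define N where "N = (\<Sum>m \<in> Poly_Mapping.keys p. n m)"
  have "Const (Poly_Mapping.lookup p m) * (Var B ^ N * (monomial (mset_of m) - monomial (mset_of (r m)))) \<in> exchange_ideal \<B>"
    if m: "m \<in> Poly_Mapping.keys p" for m
  proof -
    have "n m \<le> N" unfolding N_def by (rule member_le_sum) (use m in auto)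
    then have "Var B ^ N = Var B ^ (N - n m) * (Var B ^ n m :: ('a set, 'k) mpoly)"
      by (simp flip: power_add)
    then have "Var B ^ N * (monomial (mset_of m) - monomial (mset_of (r m)))
        = Var B ^ (N - n m) * (Var B ^ n m * (monomial (mset_of m) - monomial (mset_of (r m))) :: ('a set, 'k) mpoly)"
      by (simp add: mult.assoc)
    also have "\<dots> \<in> exchange_ideal \<B>"
      by (rule ideal_mult[OF J n[OF m]]) (intro mpoly_ring_power_closed Var_in_mpoly_ring B)
    finally show ?thesis by (rule ideal_mult[OF J _ Const_in_mpoly_ring])
  qed
  from ideal_sum[OF J this]
  have "(\<Sum>m \<in> Poly_Mapping.keys p.
      Const (Poly_Mapping.lookup p m) * (Var B ^ N * (monomial (mset_of m) - monomial (mset_of (r m))))) \<in> exchange_ideal \<B>" .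
  also have "(\<Sum>m \<in> Poly_Mapping.keys p.
      Const (Poly_Mapping.lookup p m) * (Var B ^ N * (monomial (mset_of m) - monomial (mset_of (r m)))))
    = Var B ^ N * (\<Sum>m \<in> Poly_Mapping.keys p.
      Const (Poly_Mapping.lookup p m) * (monomial (mset_of m) - monomial (mset_of (r m))))"
    by (simp add: sum_distrib_left ac_simps)
  also have "\<dots> = Var B ^ N * p" by (simp only: p_eq[symmetric])
  finally show ?thesis by blast
qed

lemma saturation_subset_toric_ideal:
  "saturation (base_ring \<B>) (exchange_ideal \<B>) (irrelevant_ideal \<B>)
    \<subseteq> (toric_ideal E \<B> :: ('a set, 'k::field) mpoly set)"
proof
  fix a :: "('a set, 'k) mpoly"
  assume "a \<in> saturation (base_ring \<B>) (exchange_ideal \<B>) (irrelevant_ideal \<B>)"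
  then obtain n where a: "a \<in> carrier (base_ring \<B>)"
    and n: "\<And>x. x \<in> ideal_power (base_ring \<B>) (irrelevant_ideal \<B>) n \<Longrightarrow> a * x \<in> exchange_ideal \<B>"
    unfolding saturation_def by auto
  obtain B where B: "B \<in> \<B>" using bases_nonempty by blast
  have "a * Var B ^ n \<in> toric_ideal E \<B>"
    using n[OF Var_power_in_ideal_power[OF B]] exchange_ideal_subset_toric_ideal by blast
  then have "toric_map (a * monomial (replicate_mset n B)) = 0"
    by (simp add: in_toric_ideal_iff)
  then have "toric_map a = 0"
    unfolding toric_map_mult toric_map_monomial by (simp only: monomial_eq_single mult_single_eq_0D)
  with a show "a \<in> toric_ideal E \<B>" by (simp add: in_toric_ideal_iff)
qed

end

theorem theorem5p4:
  fixes E :: "'a set" and \<B> :: "'a set set"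
  assumes "matroid E \<B>"
    and positive_rank: "{} \<notin> \<B>"
  shows "saturation (base_ring \<B>) (exchange_ideal \<B>) (irrelevant_ideal \<B>)
    = (toric_ideal E \<B> :: ('a set, 'k::field) mpoly set)"
proof -
  interpret matroid E \<B> by (rule assms(1))
  show ?thesis
  proof
    show "saturation (base_ring \<B>) (exchange_ideal \<B>) (irrelevant_ideal \<B>)
        \<subseteq> (toric_ideal E \<B> :: ('a set, 'k) mpoly set)"
      by (rule saturation_subset_toric_ideal)
    show "toric_ideal E \<B> \<subseteq> saturation (base_ring \<B>)
        (exchange_ideal \<B> :: ('a set, 'k) mpoly set) (irrelevant_ideal \<B>)"
    proof
      fix p :: "('a set, 'k) mpoly"
      assume p: "p \<in> toric_ideal E \<B>"
      show "p \<in> saturation (base_ring \<B>) (exchange_ideal \<B>) (irrelevant_ideal \<B>)"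
      proof (rule saturation_if_Var_power[OF exchange_ideal_ideal finite_bases irrelevant_ideal_high_degree])
        show "p \<in> carrier (base_ring \<B>)" using p by (simp add: in_toric_ideal_iff)
        show "\<exists>n. Var B ^ n * p \<in> exchange_ideal \<B>" if "B \<in> \<B>" for B
          by (rule Var_power_mult_toric_ideal[OF p positive_rank that])
      qed
    qed
  qed
qed

end
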